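(* Let $C$ and $D$ be bivariate copulas. Then: (1) $C$ is a shuffle of $D$ if and only if there exists a shuffle of Min $A$ such that $C=A*D$; (2) $C$ is a generalized shuffle of $D$ if and only if there exists a generalized shuffle of Min $A$ such that $C=A*D$.
   Context: A (bivariate) copula is a function $C\colon[0,1]^2\to[0,1]$ with $C(u,0)=0=C(0,v)$, $C(u,1)=u$, $C(1,v)=v$ and $C(u,v)-C(u,y)-C(x,v)+C(x,y)\ge 0$ whenever $x\le u$, $y\le v$. It induces a Borel measure $\mu_C$ on $[0,1]^2$ with $\mu_C([x,u]\times[y,v])=C(u,v)-C(u,y)-C(x,v)+C(x,y)$ (extended to its completion where needed). The $*$-product is $(A*D)(x,y)=\int_0^1\partial_2A(x,t)\,\partial_1D(t,y)\,dt$. A measurable function $T\colon[0,1]\to[0,1]$ is measure-preserving if $m(T^{-1}(B))=m(B)$ for every Lebesgue measurable $B\subseteq[0,1]$, $m$ being Lebesgue measure. For $T\colon[0,1]\to[0,1]$, let $S_T(u,v)=(T(u),v)$ and let $S_T*\mu$ denote the push-forward $(S_T*\mu)(E)=\mu(S_T^{-1}(E))$. A copula $C$ is a generalized shuffle of $D$ if $\mu_C=S_T*\mu_D$ for some measure-preserving bijection $T\colon[0,1]\to[0,1]$; it is a shuffle of $D$ if moreover $T$ can be chosen piecewise continuous (finitely many discontinuities). A (generalized) shuffle of Min is a (generalized) shuffle of $M(x,y)=\min(x,y)$; for shuffles of Min this is equivalent (a known result) to the original definition by permuting and possibly flipping the support of $M$ on finitely many vertical strips. *)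

theory Defs
  imports "HOL-Analysis.Analysis"
begin

text \<open>Functions on $[0,1]$ and $[0,1]^2$ are represented by total functions on the reals;
  only their values at arguments in the unit interval are relevant.\<close>

abbreviation unit_square :: "(real \<times> real) set" where
  "unit_square \<equiv> {0..1} \<times> {0..1}"

definition rect_vol :: "(real \<Rightarrow> real \<Rightarrow> real) \<Rightarrow> real \<Rightarrow> real \<Rightarrow> real \<Rightarrow> real \<Rightarrow> real" where
  "rect_vol C x u y v = C u v - C u y - C x v + C x y"

definition copula :: "(real \<Rightarrow> real \<Rightarrow> real) \<Rightarrow> bool" where
  "copula C \<longleftrightarrow>
     (\<forall>u\<in>{0..1}. \<forall>v\<in>{0..1}. C u v \<in> {0..1}) \<and>
     (\<forall>u\<in>{0..1}. C u 0 = 0 \<and> C u 1 = u) \<and>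
     (\<forall>v\<in>{0..1}. C 0 v = 0 \<and> C 1 v = v) \<and>
     (\<forall>x\<in>{0..1}. \<forall>u\<in>{0..1}. \<forall>y\<in>{0..1}. \<forall>v\<in>{0..1}.
        x \<le> u \<longrightarrow> y \<le> v \<longrightarrow> rect_vol C x u y v \<ge> 0)"

definition min_copula :: "real \<Rightarrow> real \<Rightarrow> real" where
  "min_copula x y = min x y"

text \<open>For a copula the described measure exists and is unique, because closed rectangles
  generate the Borel sets of the unit square.\<close>

definition copula_measure :: "(real \<Rightarrow> real \<Rightarrow> real) \<Rightarrow> (real \<times> real) measure" where
  "copula_measure C = (THE M.
     sets M = sets (restrict_space borel unit_square) \<and>
     (\<forall>x\<in>{0..1}. \<forall>u\<in>{0..1}. \<forall>y\<in>{0..1}. \<forall>v\<in>{0..1}. x \<le> u \<longrightarrow> y \<le> v \<longrightarrow>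
        emeasure M ({x..u} \<times> {y..v}) = ennreal (rect_vol C x u y v)))"

text \<open>The partial derivatives exist for almost every $t$; where one does not exist (or at the
  endpoints, where it may depend on values outside the unit interval), \<^const>\<open>deriv\<close> takes an
  irrelevant value on a null set.\<close>

definition star_product ::
  "(real \<Rightarrow> real \<Rightarrow> real) \<Rightarrow> (real \<Rightarrow> real \<Rightarrow> real) \<Rightarrow> real \<Rightarrow> real \<Rightarrow> real" where
  "star_product A D x y =
     (LINT t:{0..1}|lebesgue. deriv (\<lambda>s. A x s) t * deriv (\<lambda>s. D s y) t)"

definition measure_preserving :: "(real \<Rightarrow> real) \<Rightarrow> bool" where
  "measure_preserving T \<longleftrightarrow>
     T \<in> measurable (lebesgue_on {0..1}) (lebesgue_on {0..1}) \<and>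
     (\<forall>B\<in>sets (lebesgue_on {0..1}).
        emeasure (lebesgue_on {0..1}) (T -` B \<inter> {0..1}) = emeasure (lebesgue_on {0..1}) B)"

definition piecewise_continuous :: "(real \<Rightarrow> real) \<Rightarrow> bool" where
  "piecewise_continuous T \<longleftrightarrow> finite {x\<in>{0..1}. \<not> continuous (at x within {0..1}) T}"

text \<open>The push-forward is taken from the completion, since preimages of Borel sets under
  $(u,v) \mapsto (T(u),v)$ need not be Borel when $T$ is only Lebesgue measurable.\<close>

definition push_fst :: "(real \<Rightarrow> real) \<Rightarrow> (real \<times> real) measure \<Rightarrow> (real \<times> real) measure" where
  "push_fst T M = distr (completion M) (restrict_space borel unit_square) (\<lambda>(u, v). (T u, v))"

definition generalized_shuffle ::
  "(real \<Rightarrow> real \<Rightarrow> real) \<Rightarrow> (real \<Rightarrow> real \<Rightarrow> real) \<Rightarrow> bool" where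
  "generalized_shuffle C D \<longleftrightarrow> copula C \<and> copula D \<and>
     (\<exists>T. bij_betw T {0..1} {0..1} \<and> measure_preserving T \<and>
          copula_measure C = push_fst T (copula_measure D))"

definition shuffle :: "(real \<Rightarrow> real \<Rightarrow> real) \<Rightarrow> (real \<Rightarrow> real \<Rightarrow> real) \<Rightarrow> bool" where
  "shuffle C D \<longleftrightarrow> copula C \<and> copula D \<and>
     (\<exists>T. bij_betw T {0..1} {0..1} \<and> measure_preserving T \<and> piecewise_continuous T \<and>
          copula_measure C = push_fst T (copula_measure D))"

end

theory Submission
  imports Defs
begin

text \<open>Fix a measure-preserving \<open>T\<close> and write \<open>B\<^sub>x\<close> for the preimage of \<open>[0,x]\<close> under \<open>T\<close>. The
theorem is true because the same \<open>T\<close> serves on both sides. If \<open>A\<close> is the shuffle of the minimum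
copula by \<open>T\<close>, its mass sits on the image of the diagonal, so \<open>A(x,s)\<close> is the Lebesgue measure
of \<open>B\<^sub>x \<inter> [0,s]\<close>. By Lebesgue differentiation the partial derivative \<open>\<partial>\<^sub>2A(x,t)\<close> is, for almost
every \<open>t\<close>, the indicator of \<open>B\<^sub>x\<close>. On the other side \<open>\<partial>\<^sub>1D(t,y)\<close> is the density of the measure
that sends \<open>B\<close> to \<open>\<mu>\<^sub>D(B \<times> [0,y])\<close>. Hence
\<open>(A * D)(x,y) = \<integral>\<^bsub>B\<^sub>x\<^esub> \<partial>\<^sub>1D(t,y) dt = \<mu>\<^sub>D(B\<^sub>x \<times> [0,y])\<close>,
which is the mass that the push-forward of \<open>\<mu>\<^sub>D\<close> by \<open>(u,v) \<mapsto> (T(u),v)\<close> gives to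
\<open>[0,x] \<times> [0,y]\<close> (\<open>star_product_shuffle_of_min\<close>). A copula measure is determined by its values on
these rectangles, so \<open>C = A * D\<close> says exactly that \<open>\<mu>\<^sub>C\<close> is the push-forward of \<open>\<mu>\<^sub>D\<close>
(\<open>push_fst_iff_star_product\<close>). Extra conditions on \<open>T\<close>, such as bijectivity or piecewise
continuity, are carried along unchanged.

Three facts carry the argument. \<open>AE_has_real_derivative_density\<close> is the Lebesgue differentiation
theorem for bounded densities on the line, obtained from the Vitali covering theorem.
\<open>ex_density_of_mono_lipschitz\<close> provides the densities, since a copula is nondecreasing and
1-Lipschitz in each variable. \<open>ex_cdf_measure\<close> constructs \<open>\<mu>\<^sub>C\<close> as the law of \<open>(t, Q(t,s))\<close> for
uniform \<open>(t,s)\<close>, where \<open>Q(t,\<cdot>)\<close> is the quantile function of the conditional distribution whose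
distribution function is \<open>\<partial>\<^sub>1C(t,\<cdot>)\<close>.\<close>

section \<open>Lebesgue differentiation on the unit interval\<close>

text \<open>Let \<open>W\<close> be the union of the disjoint intervals selected by Vitali's theorem from those on which \<open>f\<close>
has slope above \<open>q\<close>. Then \<open>q |W| \<le> \<integral>\<^bsub>W\<^esub> g\<close>. If the intervals lie in an open set that exceeds
\<open>{g < p}\<close> by little, then \<open>\<integral>\<^bsub>W\<^esub> g\<close> is hardly more than \<open>p |W|\<close>, so \<open>|W|\<close> is small. Up to
a null set \<open>W\<close> covers the exceptional set.\<close>
lemma negligible_upper_derivative_exceeds_density:
  fixes f g :: "real \<Rightarrow> real"
  assumes g[measurable]: "g \<in> borel_measurable borel" and g01: "\<And>t. 0 \<le> g t" "\<And>t. g t \<le> 1"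
    and int: "\<And>a b. 0 \<le> a \<Longrightarrow> a \<le> b \<Longrightarrow> b \<le> 1 \<Longrightarrow>
           (\<integral>\<^sup>+t\<in>{a..b}. ennreal (g t) \<partial>lborel) = ennreal (f b - f a)"
    and pq: "p < q"
  shows "negligible {x\<in>{0<..<1}. g x < p \<and>
     (\<forall>d>0. \<exists>a b. 0 \<le> a \<and> a \<le> x \<and> x \<le> b \<and> b \<le> 1 \<and> a < b \<and> b - a < d \<and> f b - f a > q * (b - a))}"
    (is "negligible ?E")
proof (cases "p > 0")
  case False
  then have "\<not> g x < p" for x using g01(1)[of x] by linarith
  then have "?E = {}" by blast
  then show ?thesis by (simp only: negligible_empty)
next
  case p: True
  define G where "G = {x\<in>{0..1}. g x < p}"
  have G[measurable]: "G \<in> sets borel" unfolding G_def by measurable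
  show ?thesis
  proof (subst negligible_outer_le, intro allI impI)
    fix e :: real assume e: "e > 0"
    have e': "e * (q - p) > 0" using e pq by simp
    \<comment> \<open>The tolerance \<open>e * (q - p)\<close> is what the final comparison
      \<open>q |W| \<le> p |W| + e * (q - p)\<close> turns into \<open>|W| \<le> e\<close>.\<close>
    obtain U where U: "open U" "G \<subseteq> U" "emeasure lborel (U - G) < e * (q - p)"
      using outer_regular_lborel[OF G e'] by blast
    have [measurable]: "U \<in> sets borel" using U(1) by simp
    define K where "K = {i :: real \<times> real. snd i > 0 \<and> cball (fst i) (snd i) \<subseteq> U \<inter> {0..1}
        \<and> f (fst i + snd i) - f (fst i - snd i) > q * (2 * snd i)}"
    have cover: "\<exists>i. i \<in> K \<and> x \<in> cball (fst i) (snd i) \<and> snd i < d" if x: "x \<in> ?E" and d: "0 < d" for x d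
    proof -
      from x have "x \<in> U" using U(2) by (auto simp: G_def)
      then obtain r where r: "r > 0" "ball x r \<subseteq> U" using U(1) openE by blast
      obtain a b where ab: "0 \<le> a" "a \<le> x" "x \<le> b" "b \<le> 1" "a < b" "b - a < min r d" "f b - f a > q * (b - a)"
        using x r(1) d by (auto dest!: spec[of _ "min r d"])
      let ?i = "((a + b) / 2, (b - a) / 2)"
      have cb: "cball (fst ?i) (snd ?i) = {a..b}"
        by (auto simp: cball_eq_atLeastAtMost field_simps)
      have "{a..b} \<subseteq> ball x r" using ab by (auto simp: dist_real_def)
      then have "?i \<in> K" using ab r(2) cb by (auto simp: K_def add_divide_distrib diff_divide_distrib)
      then show ?thesis using cb ab by (intro exI[of _ ?i]) auto
    qed
    obtain C where C: "countable C" "C \<subseteq> K"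
        "pairwise (\<lambda>i j. disjnt (cball (fst i) (snd i)) (cball (fst j) (snd j))) C"
        "negligible (?E - (\<Union>i \<in> C. cball (fst i) (snd i)))"
      by (rule Vitali_covering_theorem_cballs[of K snd ?E fst]) (use cover in \<open>auto simp: K_def\<close>)
    define W where "W = (\<Union>i\<in>C. cball (fst i) (snd i))"
    have W[measurable]: "W \<in> sets borel" unfolding W_def using C(1) by (intro sets.countable_UN') auto
    have disj: "disjoint_family_on (\<lambda>i. cball (fst i) (snd i)) C"
      using C(3) by (auto simp: disjoint_family_on_def pairwise_def disjnt_def)
    have WU: "W \<subseteq> U" "W \<subseteq> {0..1}" using C(2) by (auto simp: W_def K_def)
    have fin: "emeasure lborel W \<le> 1"
      using emeasure_mono[OF WU(2), of lborel] by simp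
    have qp: "0 < q" using p pq by simp
    have "ennreal q * emeasure lborel W = (\<integral>\<^sup>+i. ennreal q * emeasure lborel (cball (fst i) (snd i)) \<partial>count_space C)"
      unfolding W_def using C(1) disj by (subst emeasure_UN_countable) (auto simp: nn_integral_cmult)
    also have "\<dots> \<le> (\<integral>\<^sup>+i. emeasure (density lborel g) (cball (fst i) (snd i)) \<partial>count_space C)"
    proof (rule nn_integral_mono)
      fix i assume "i \<in> space (count_space C)"
      then have i: "i \<in> K" using C(2) by auto
      obtain c r where ir: "i = (c, r)" by (cases i)
      have r: "r > 0" "{c-r..c+r} \<subseteq> {0..1}" "f (c+r) - f (c-r) > q * (2 * r)"
        using i by (auto simp: K_def ir cball_eq_atLeastAtMost)
      then have b: "0 \<le> c - r" "c + r \<le> 1" by auto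
      have "emeasure (density lborel g) {c-r..c+r} = ennreal (f (c+r) - f (c-r))"
        using int[of "c-r" "c+r"] b r(1) by (simp add: emeasure_density)
      moreover have "ennreal q * emeasure lborel {c-r..c+r} = ennreal (q * (2 * r))"
        using r(1) qp by (simp add: ennreal_mult[symmetric])
      ultimately show "ennreal q * emeasure lborel (cball (fst i) (snd i)) \<le> emeasure (density lborel g) (cball (fst i) (snd i))"
        using r(3) by (simp add: ir cball_eq_atLeastAtMost ennreal_leI)
    qed
    also have "\<dots> = emeasure (density lborel g) W"
      unfolding W_def using C(1) disj by (subst emeasure_UN_countable) auto
    also have "\<dots> = (\<integral>\<^sup>+t. ennreal (g t) * indicator W t \<partial>lborel)"
      by (simp add: emeasure_density)
    also have "\<dots> \<le> (\<integral>\<^sup>+t. ennreal p * indicator W t + indicator (U - G) t \<partial>lborel)"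
    proof (rule nn_integral_mono)
      fix t
      show "ennreal (g t) * indicator W t \<le> ennreal p * indicator W t + indicator (U - G) t"
      proof (cases "t \<in> W")
        case True
        then have "t \<in> U" "t \<in> {0..1}" using WU by auto
        show ?thesis
        proof (cases "g t < p")
          case True
          then show ?thesis using \<open>t \<in> W\<close> by (auto intro!: add_increasing2 ennreal_leI)
        next
          case False
          then have "t \<in> U - G" using \<open>t \<in> U\<close> by (auto simp: G_def)
          then show ?thesis using \<open>t \<in> W\<close> g01(2)[of t] by (auto intro!: add_increasing simp: ennreal_le_1)
        qed
      qed simp
    qed
    also have "\<dots> = ennreal p * emeasure lborel W + emeasure lborel (U - G)"
      by (simp add: nn_integral_add nn_integral_cmult)
    also have "\<dots> \<le> ennreal p * emeasure lborel W + ennreal (e * (q - p))"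
      using U(3) by (intro add_left_mono) auto
    finally have *: "ennreal q * emeasure lborel W \<le> ennreal p * emeasure lborel W + ennreal (e * (q - p))" .
    have Wfin: "emeasure lborel W = ennreal (measure lborel W)"
      using fin by (intro emeasure_eq_ennreal_measure) (auto simp: top_unique)
    have "q * measure lborel W \<le> p * measure lborel W + e * (q - p)"
      using * qp p e' unfolding Wfin by (simp add: ennreal_mult[symmetric] ennreal_plus[symmetric] del: ennreal_plus)
    then have "(q - p) * measure lborel W \<le> (q - p) * e" by (simp add: algebra_simps)
    then have mW: "measure lborel W \<le> e" using pq by simp
    have "W \<in> lmeasurable" using fin by (intro fmeasurableI) (auto simp: top_unique less_top[symmetric])
    have N: "(?E - W) \<in> lmeasurable" "measure lebesgue (?E - W) = 0"
      using C(4) by (auto simp: W_def negligible_iff_measure)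
    show "\<exists>T. ?E \<subseteq> T \<and> T \<in> lmeasurable \<and> measure lebesgue T \<le> e"
    proof (intro exI[of _ "(?E - W) \<union> W"] conjI)
      show "?E - W \<union> W \<in> lmeasurable" using N(1) \<open>W \<in> lmeasurable\<close> by (rule fmeasurable.Un)
      have "measure lebesgue (?E - W \<union> W) \<le> measure lebesgue (?E - W) + measure lebesgue W"
        using N(1) \<open>W \<in> lmeasurable\<close> by (intro measure_Un_le) auto
      also have "\<dots> \<le> e" using N(2) mW by simp
      finally show "measure lebesgue (?E - W \<union> W) \<le> e" .
    qed auto
  qed
qed

text \<open>The upper bound for the slopes of \<open>f\<close> comes from the previous lemma, with \<open>p\<close> and \<open>q\<close> running
over the rationals. The lower bound is the upper bound for \<open>t - f t\<close>, whose density is \<open>1 - g\<close>.\<close>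
lemma AE_has_real_derivative_density:
  fixes f g :: "real \<Rightarrow> real"
  assumes g[measurable]: "g \<in> borel_measurable borel" and g01: "\<And>t. 0 \<le> g t" "\<And>t. g t \<le> 1"
    and mono: "\<And>a b. 0 \<le> a \<Longrightarrow> a \<le> b \<Longrightarrow> b \<le> 1 \<Longrightarrow> f a \<le> f b"
    and int: "\<And>a b. 0 \<le> a \<Longrightarrow> a \<le> b \<Longrightarrow> b \<le> 1 \<Longrightarrow>
           (\<integral>\<^sup>+t\<in>{a..b}. ennreal (g t) \<partial>lborel) = ennreal (f b - f a)"
  shows "AE t in lborel. t \<in> {0<..<1} \<longrightarrow> (f has_real_derivative g t) (at t)"
proof -
  define f' where "f' = (\<lambda>t. t - f t)"
  define g' where "g' = (\<lambda>t. 1 - g t)"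
  have int': "(\<integral>\<^sup>+t\<in>{a..b}. ennreal (g' t) \<partial>lborel) = ennreal (f' b - f' a)"
    if ab: "0 \<le> a" "a \<le> b" "b \<le> 1" for a b
  proof -
    have "(\<integral>\<^sup>+t\<in>{a..b}. ennreal (g' t) \<partial>lborel) = (\<integral>\<^sup>+t. (indicator {a..b} t - ennreal (g t) * indicator {a..b} t) \<partial>lborel)"
      using g01 by (intro nn_integral_cong) (auto simp: g'_def indicator_def ennreal_minus[symmetric])
    also have "\<dots> = (\<integral>\<^sup>+t. indicator {a..b} t \<partial>lborel) - ennreal (f b - f a)"
      unfolding int[OF ab, symmetric]
    proof (rule nn_integral_diff)
      show "(\<integral>\<^sup>+t\<in>{a..b}. ennreal (g t) \<partial>lborel) \<noteq> \<infinity>" by (simp only: int[OF ab]) simp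
      show "AE t in lborel. ennreal (g t) * indicator {a..b} t \<le> indicator {a..b} t"
        using g01 by (intro AE_I2) (simp add: indicator_def ennreal_le_1)
    qed measurable
    also have "\<dots> = ennreal (f' b - f' a)"
      using ab mono[OF ab] by (simp add: ennreal_minus f'_def algebra_simps)
    finally show ?thesis .
  qed
  define E where "E f g p q = {x\<in>{0<..<1::real}. g x < p \<and>
     (\<forall>d>0. \<exists>a b. 0 \<le> a \<and> a \<le> x \<and> x \<le> b \<and> b \<le> 1 \<and> a < b \<and> b - a < d \<and> f b - f a > q * (b - a))}"
    for f g :: "real \<Rightarrow> real" and p q :: real
  have neg1: "negligible (E f g p q)" if "p < q" for p q
    unfolding E_def by (rule negligible_upper_derivative_exceeds_density[OF g g01 int that])
  have neg2: "negligible (E f' g' p q)" if "p < q" for p q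
    unfolding E_def
    by (rule negligible_upper_derivative_exceeds_density[OF _ _ _ int' that]) (use g01 in \<open>auto simp: g'_def\<close>)
  define N where "N = (\<Union>(p,q) \<in> {(p,q) \<in> \<rat>\<times>\<rat>. p < q}. E f g p q \<union> E f' g' p q)"
  have "countable {(p,q) \<in> \<rat>\<times>(\<rat>::real set). p < q}"
    by (rule countable_subset[of _ "\<rat>\<times>\<rat>"]) (auto intro: countable_rat)
  then have "negligible N" unfolding N_def
    by (intro negligible_countable_Union) (auto intro!: neg1 neg2 negligible_Un)
  then have "AE t in lebesgue. t \<notin> N"
    by (metis AE_not_in negligible_iff_null_sets)
  then have "AE t in lborel. t \<notin> N" by (simp add: AE_completion_iff)
  then show ?thesis
  proof (rule AE_mp, intro AE_I2 impI)
    fix x :: real assume xN: "x \<notin> N" and x: "x \<in> {0<..<1}"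
    have upper: "\<exists>d>0. \<forall>a b. 0 \<le> a \<and> a \<le> x \<and> x \<le> b \<and> b \<le> 1 \<and> a < b \<and> b - a < d \<longrightarrow> h b - h a \<le> (k x + e) * (b - a)"
      if hk: "\<And>p q. p \<in> \<rat> \<Longrightarrow> q \<in> \<rat> \<Longrightarrow> p < q \<Longrightarrow> x \<notin> E h k p q" and e: "e > 0" for h k and e :: real
    proof -
      obtain q where q: "q \<in> \<rat>" "k x < q" "q < k x + e" using Rats_dense_in_real[of "k x" "k x + e"] e by auto
      obtain p where p: "p \<in> \<rat>" "k x < p" "p < q" using Rats_dense_in_real[of "k x" q] q by auto
      from hk[OF p(1) q(1) p(3)] x p(2) obtain d where d: "d > 0"
        "\<And>a b. 0 \<le> a \<Longrightarrow> a \<le> x \<Longrightarrow> x \<le> b \<Longrightarrow> b \<le> 1 \<Longrightarrow> a < b \<Longrightarrow> b - a < d \<Longrightarrow> h b - h a \<le> q * (b - a)"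
        unfolding E_def by (smt (verit) mem_Collect_eq)
      show ?thesis
      proof (intro exI[of _ d] conjI allI impI d(1))
        fix a b assume *: "0 \<le> a \<and> a \<le> x \<and> x \<le> b \<and> b \<le> 1 \<and> a < b \<and> b - a < d"
        then have "h b - h a \<le> q * (b - a)" using d(2) by blast
        also have "\<dots> \<le> (k x + e) * (b - a)" using q * by (intro mult_right_mono) auto
        finally show "h b - h a \<le> (k x + e) * (b - a)" .
      qed
    qed
    have nE: "x \<notin> E f g p q" "x \<notin> E f' g' p q" if "p \<in> \<rat>" "q \<in> \<rat>" "p < q" for p q
      using xN that unfolding N_def by auto
    show "(f has_real_derivative g x) (at x)"
      unfolding has_field_derivative_iff
    proof (rule LIM_I)
      fix e :: real assume "e > 0"
      define e' where "e' = e / 2"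
      have e': "0 < e'" "e' < e" using \<open>e > 0\<close> by (auto simp: e'_def)
      have upper1: "\<exists>d>0. \<forall>a b. 0 \<le> a \<and> a \<le> x \<and> x \<le> b \<and> b \<le> 1 \<and> a < b \<and> b - a < d \<longrightarrow> f b - f a \<le> (g x + e') * (b - a)"
        by (rule upper) (use nE(1) e' in auto)
      have upper2: "\<exists>d>0. \<forall>a b. 0 \<le> a \<and> a \<le> x \<and> x \<le> b \<and> b \<le> 1 \<and> a < b \<and> b - a < d \<longrightarrow> f' b - f' a \<le> (g' x + e') * (b - a)"
        by (rule upper) (use nE(2) e' in auto)
      from upper1 obtain d1 where d1: "d1 > 0" and D1: "\<forall>a b. 0 \<le> a \<and> a \<le> x \<and> x \<le> b \<and> b \<le> 1 \<and> a < b \<and> b - a < d1 \<longrightarrow> f b - f a \<le> (g x + e') * (b - a)"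
        by (elim exE conjE)
      from upper2 obtain d2 where d2: "d2 > 0" and D2: "\<forall>a b. 0 \<le> a \<and> a \<le> x \<and> x \<le> b \<and> b \<le> 1 \<and> a < b \<and> b - a < d2 \<longrightarrow> f' b - f' a \<le> (g' x + e') * (b - a)"
        by (elim exE conjE)
      define d where "d = Min {d1, d2, x, 1 - x}"
      have d: "d > 0" "d \<le> d1" "d \<le> d2" "d \<le> x" "d \<le> 1 - x" using d1 d2 x by (auto simp: d_def)
      have key: "\<bar>(f b - f a) / (b - a) - g x\<bar> < e" if ab: "a \<le> x" "x \<le> b" "a < b" "b - a < d" for a b
      proof -
        have ab': "0 \<le> a" "b \<le> 1" using ab d by auto
        have "f b - f a \<le> (g x + e') * (b - a)" using D1[rule_format, of a b] ab ab' d by linarith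
        then have 1: "(f b - f a) / (b - a) \<le> g x + e'" using ab by (simp add: divide_le_eq)
        have "f' b - f' a \<le> (g' x + e') * (b - a)" using D2[rule_format, of a b] ab ab' d by linarith
        then have "f b - f a \<ge> (g x - e') * (b - a)" by (simp add: f'_def g'_def algebra_simps)
        then have 2: "(f b - f a) / (b - a) \<ge> g x - e'" using ab by (simp add: le_divide_eq)
        from 1 2 e' show ?thesis by auto
      qed
      show "\<exists>s>0. \<forall>y. y \<noteq> x \<and> norm (y - x) < s \<longrightarrow> norm ((f y - f x) / (y - x) - g x) < e"
      proof (intro exI[of _ d] conjI allI impI d(1))
        fix y assume y: "y \<noteq> x \<and> norm (y - x) < d"
        show "norm ((f y - f x) / (y - x) - g x) < e"
        proof (cases "x < y")
          case True
          then show ?thesis using key[of x y] y by simp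
        next
          case False
          have "(f y - f x) / (y - x) = (f x - f y) / (x - y)"
            by (simp add: minus_divide_divide[of "f x - f y" "x - y", symmetric])
          then show ?thesis using key[of y x] y False by simp
        qed
      qed
    qed
  qed
qed

text \<open>Both \<open>f\<close> and \<open>t - f t\<close> are nondecreasing, and their Stieltjes measures add up to Lebesgue measure.
Each of them is therefore absolutely continuous, and the two Radon-Nikodym densities add up to 1,
which bounds them.\<close>
lemma ex_density_of_mono_lipschitz:
  fixes f :: "real \<Rightarrow> real"
  assumes mono: "\<And>a b. 0 \<le> a \<Longrightarrow> a \<le> b \<Longrightarrow> b \<le> 1 \<Longrightarrow> f a \<le> f b"
    and lip: "\<And>a b. 0 \<le> a \<Longrightarrow> a \<le> b \<Longrightarrow> b \<le> 1 \<Longrightarrow> f b - f a \<le> b - a"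
  obtains g where "g \<in> borel_measurable borel" "\<And>t. 0 \<le> g t" "\<And>t. g t \<le> 1"
    "\<And>a b. 0 \<le> a \<Longrightarrow> a \<le> b \<Longrightarrow> b \<le> 1 \<Longrightarrow>
           (\<integral>\<^sup>+t\<in>{a..b}. ennreal (g t) \<partial>lborel) = ennreal (f b - f a)"
proof -
  \<comment> \<open>\<open>F\<close> extends \<open>f\<close> by constants to the whole line, as Stieltjes measures require.\<close>
  define c where "c t = max 0 (min 1 t)" for t :: real
  define F where "F = (\<lambda>t. f (c t))"
  define H where "H = (\<lambda>t. t - F t)"
  have Fmono: "F x \<le> F y" and Flip: "F y - F x \<le> y - x" if "x \<le> y" for x y
  proof -
    have c: "0 \<le> c x" "c x \<le> c y" "c y \<le> 1" "c y - c x \<le> y - x" using that by (auto simp: c_def)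
    show "F x \<le> F y" using mono c by (auto simp: F_def)
    show "F y - F x \<le> y - x" using lip[OF c(1,2,3)] c(4) by (auto simp: F_def)
  qed
  have Hmono: "H x \<le> H y" if "x \<le> y" for x y using Flip[OF that] by (simp add: H_def)
  have "1-lipschitz_on UNIV F"
  proof (rule lipschitz_onI)
    show "dist (F x) (F y) \<le> 1 * dist x y" for x y
      using Flip[of x y] Flip[of y x] Fmono[of x y] Fmono[of y x] by (cases "x \<le> y") (auto simp: dist_real_def)
  qed simp
  then have Fc: "continuous_on UNIV F" by (rule lipschitz_on_continuous_on)
  then have Hc: "continuous_on UNIV H" unfolding H_def by (intro continuous_intros)
  have Fr: "continuous (at_right a) F" and Hr: "continuous (at_right a) H" for a
    using Fc Hc by (auto simp: continuous_on_eq_continuous_within intro: continuous_within_subset)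
  let ?\<mu> = "interval_measure F" and ?\<nu> = "interval_measure H"
  define S where "S = measure_of UNIV (sets borel) (\<lambda>A. emeasure ?\<mu> A + emeasure ?\<nu> A)"
  have setsS: "sets S = sets borel"
    unfolding S_def by (simp add: sets.sigma_sets_eq[of borel, simplified])
  have emS: "emeasure S A = emeasure ?\<mu> A + emeasure ?\<nu> A" if "A \<in> sets borel" for A
    unfolding S_def
  proof (rule emeasure_measure_of_sigma)
    show "sigma_algebra UNIV (sets (borel::real measure))"
      using sets.sigma_algebra_axioms[of "borel::real measure"] by simp
    show "positive (sets borel) (\<lambda>A. emeasure ?\<mu> A + emeasure ?\<nu> A)"
      by (simp add: positive_def)
    show "countably_additive (sets borel) (\<lambda>A. emeasure ?\<mu> A + emeasure ?\<nu> A)"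
      unfolding countably_additive_def
    proof (intro allI impI)
      fix A :: "nat \<Rightarrow> real set" assume A: "range A \<subseteq> sets borel" "disjoint_family A"
      then show "(\<Sum>i. emeasure ?\<mu> (A i) + emeasure ?\<nu> (A i)) = emeasure ?\<mu> (\<Union> (range A)) + emeasure ?\<nu> (\<Union> (range A))"
        by (subst suminf_add[symmetric]) (auto simp: suminf_emeasure)
    qed
  qed (use that in simp)
  have "lborel = S"
  proof (rule lborel_eqI)
    fix l u :: real assume lu: "\<And>b. b \<in> Basis \<Longrightarrow> l \<bullet> b \<le> u \<bullet> b"
    then have "l \<le> u" by simp
    have sing: "emeasure ?\<mu> {u} = 0" "emeasure ?\<nu> {u} = 0"
      using emeasure_interval_measure_Icc[of u u, OF _ Fmono Fc] emeasure_interval_measure_Icc[of u u, OF _ Hmono Hc] by auto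
    have *: "emeasure m {l<..<u} = emeasure m {l<..u}" if "sets m = sets borel" "emeasure m {u} = 0" for m :: "real measure"
    proof (rule emeasure_eq_AE)
      have "{u} \<in> null_sets m" using that by auto
      then have "AE x in m. x \<notin> {u}" by (rule AE_not_in)
      then show "AE x in m. (x \<in> {l<..<u}) = (x \<in> {l<..u})" by eventually_elim auto
    qed (auto simp: that)
    have "emeasure S (box l u) = ennreal (F u - F l) + ennreal (H u - H l)"
      using \<open>l \<le> u\<close> by (simp add: box_real emS * sing emeasure_interval_measure_Ioc[OF _ Fmono Fr] emeasure_interval_measure_Ioc[OF _ Hmono Hr])
    also have "\<dots> = ennreal (u - l)"
      using Fmono[OF \<open>l \<le> u\<close>] Hmono[OF \<open>l \<le> u\<close>] by (simp add: ennreal_plus[symmetric] H_def del: ennreal_plus)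
    finally show "emeasure S (box l u) = ennreal (\<Prod>b\<in>Basis. (u - l) \<bullet> b)" by simp
  qed (simp add: setsS)
  then have sum: "emeasure lborel A = emeasure ?\<mu> A + emeasure ?\<nu> A" if "A \<in> sets borel" for A
    using emS[OF that] by simp
  have ac: "absolutely_continuous lborel ?\<mu>" "absolutely_continuous lborel ?\<nu>"
    unfolding absolutely_continuous_def using sum by (force simp: null_sets_def)+
  obtain k where k[measurable]: "k \<in> borel_measurable borel" "density lborel k = ?\<mu>"
    using sigma_finite_measure.Radon_Nikodym[OF sigma_finite_lborel ac(1)] by auto
  obtain h where h[measurable]: "h \<in> borel_measurable borel" "density lborel h = ?\<nu>"
    using sigma_finite_measure.Radon_Nikodym[OF sigma_finite_lborel ac(2)] by auto
  have "density lborel (\<lambda>t. k t + h t) = density lborel (\<lambda>t. 1)"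
  proof (rule measure_eqI)
    fix A assume "A \<in> sets (density lborel (\<lambda>t. k t + h t))"
    then have A[measurable]: "A \<in> sets borel" by simp
    have "emeasure (density lborel (\<lambda>t. k t + h t)) A = emeasure (density lborel k) A + emeasure (density lborel h) A"
      by (simp add: emeasure_density distrib_right nn_integral_add)
    then show "emeasure (density lborel (\<lambda>t. k t + h t)) A = emeasure (density lborel (\<lambda>t. 1)) A"
      by (simp add: k(2) h(2) sum[OF A] density_1)
  qed simp
  then have "AE t in lborel. k t + h t = 1"
    by (intro sigma_finite_measure.density_unique[OF sigma_finite_lborel]) auto
  then have kle: "AE t in lborel. k t \<le> 1"
  proof eventually_elim
    case (elim t) then show ?case by (metis add_increasing2 order_refl zero_le)
  qed
  define g where "g t = enn2real (min 1 (k t))" for t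
  show ?thesis
  proof (rule that[of g])
    show "g \<in> borel_measurable borel" unfolding g_def by measurable
    show "0 \<le> g t" for t by (simp add: g_def)
    show "g t \<le> 1" for t unfolding g_def by (rule enn2real_leI) auto
    fix a b :: real assume ab: "0 \<le> a" "a \<le> b" "b \<le> 1"
    have "(\<integral>\<^sup>+t\<in>{a..b}. ennreal (g t) \<partial>lborel) = (\<integral>\<^sup>+t\<in>{a..b}. k t \<partial>lborel)"
    proof (rule nn_integral_cong_AE)
      show "AE t in lborel. ennreal (g t) * indicator {a..b} t = k t * indicator {a..b} t"
        using kle
      proof eventually_elim
        case (elim t)
        then have "k t < top" by (metis ennreal_one_less_top order_le_less_trans)
        then show ?case using elim by (simp add: g_def min_def)
      qed
    qed
    also have "\<dots> = emeasure ?\<mu> {a..b}" by (simp add: k(2)[symmetric] emeasure_density)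
    also have "\<dots> = ennreal (F b - F a)" by (rule emeasure_interval_measure_Icc[OF ab(2) Fmono Fc])
    also have "\<dots> = ennreal (f b - f a)" using ab by (simp add: F_def c_def)
    finally show "(\<integral>\<^sup>+t\<in>{a..b}. ennreal (g t) \<partial>lborel) = ennreal (f b - f a)" .
  qed
qed

section \<open>Distribution functions of measures on the unit square\<close>
lemma measure_eqI_atMost:
  fixes M N :: "'a::ordered_euclidean_space measure"
  assumes sets: "sets M = sets borel" "sets N = sets borel"
    and eq: "\<And>a. emeasure M {..a} = emeasure N {..a}"
    and fin: "emeasure M UNIV \<noteq> \<infinity>"
  shows "M = N"
proof (rule measure_eqI_generator_eq)
  let ?E = "range (\<lambda>a::'a. {..a})"
  show "Int_stable ?E"
  proof (rule Int_stableI)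
    fix A B assume "A \<in> ?E" "B \<in> ?E"
    then obtain a b where "A = {..a}" "B = {..b}" by auto
    then have "A \<inter> B = {..inf a b}" by auto
    then show "A \<inter> B \<in> ?E" by blast
  qed
  show "sets M = sigma_sets UNIV ?E" "sets N = sigma_sets UNIV ?E"
    using sets by (simp_all add: borel_eq_atMost)
  let ?A = "\<lambda>n::nat. {..real n *\<^sub>R (One::'a)}"
  show "range ?A \<subseteq> ?E" by auto
  show "(\<Union>n. ?A n) = UNIV"
  proof (intro equalityI subsetI)
    fix x :: 'a
    obtain n where "norm x \<le> real n" using real_arch_simple by blast
    then have "x \<in> ?A n"
      by (auto simp: eucl_le[where 'a='a] intro: order_trans[OF Basis_le_norm] order_trans[OF abs_ge_self])
    then show "x \<in> (\<Union>n. ?A n)" by blast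
  qed simp
  show "emeasure M (?A i) \<noteq> \<infinity>" for i
  proof -
    have "emeasure M (?A i) \<le> emeasure M UNIV" by (intro emeasure_mono) (auto simp: sets)
    then show ?thesis using fin by (auto simp: top_unique)
  qed
qed (use eq in auto)

text \<open>For a copula \<open>F\<close> this is equivalent to prescribing the mass of every closed rectangle. Rectangles
with a corner at the origin form a generator stable under intersection, so that uniqueness is immediate,
and they are all that has to be computed for a push-forward.\<close>
definition cdf_measure :: "(real \<Rightarrow> real \<Rightarrow> real) \<Rightarrow> (real \<times> real) measure \<Rightarrow> bool" where
  "cdf_measure F M \<longleftrightarrow> sets M = sets (restrict_space borel unit_square) \<and>
     (\<forall>x\<in>{0..1}. \<forall>y\<in>{0..1}. emeasure M ({0..x} \<times> {0..y}) = ennreal (F x y))"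

lemma borel_square [measurable]: "A \<in> sets borel \<Longrightarrow> B \<in> sets borel \<Longrightarrow> A \<times> B \<in> sets (borel :: (real \<times> real) measure)"
  by (simp add: borel_prod[symmetric])

lemma sets_square_iff:
  "A \<in> sets (restrict_space borel unit_square) \<longleftrightarrow> A \<subseteq> unit_square \<and> A \<in> sets borel"
  by (subst sets_restrict_space_iff) (auto simp: borel_square)

lemma space_square: "sets M = sets (restrict_space borel unit_square) \<Longrightarrow> space M = unit_square"
  by (drule sets_eq_imp_space_eq) (simp add: space_restrict_space)

lemma cdf_measure_D:
  assumes "cdf_measure F M"
  shows "sets M = sets (restrict_space borel unit_square)" "space M = unit_square"
    "\<And>x y. x \<in> {0..1} \<Longrightarrow> y \<in> {0..1} \<Longrightarrow> emeasure M ({0..x} \<times> {0..y}) = ennreal (F x y)"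
    "finite_measure M"
proof -
  show s: "sets M = sets (restrict_space borel unit_square)" 
    and e: "\<And>x y. x \<in> {0..1} \<Longrightarrow> y \<in> {0..1} \<Longrightarrow> emeasure M ({0..x} \<times> {0..y}) = ennreal (F x y)"
    using assms by (auto simp: cdf_measure_def)
  show sp: "space M = unit_square" by (rule space_square[OF s])
  show "finite_measure M" by (rule finite_measureI) (simp add: sp e)
qed

lemma measurable_id_square:
  assumes "sets M = sets (restrict_space borel unit_square)"
  shows "(\<lambda>z. z) \<in> M \<rightarrow>\<^sub>M borel"
proof -
  have "(\<lambda>z. z) \<in> restrict_space borel unit_square \<rightarrow>\<^sub>M borel"
    by (intro measurable_restrict_space1) simp
  then show ?thesis by (subst measurable_cong_sets[OF assms refl])
qed

lemma atMost_prod: "{..a} = {..fst a} \<times> {..snd a}" for a :: "real \<times> real"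
  by (auto simp: less_eq_prod_def)

lemma cdf_measure_unique:
  assumes M: "cdf_measure F M" and N: "cdf_measure F N"
  shows "M = N"
proof -
  note M' = cdf_measure_D[OF M] and N' = cdf_measure_D[OF N]
  have em: "emeasure (distr K borel (\<lambda>z. z)) A = emeasure K (A \<inter> unit_square)"
    if "cdf_measure F K" "A \<in> sets borel" for K A
    using that(2) cdf_measure_D[OF that(1)]
    by (subst emeasure_distr) (auto simp: measurable_id_square Int_commute)
  have low: "emeasure K ({..a} \<inter> unit_square) =
      (if fst a < 0 \<or> snd a < 0 then 0 else ennreal (F (min 1 (fst a)) (min 1 (snd a))))"
    if "cdf_measure F K" for K a
  proof (cases "fst a < 0 \<or> snd a < 0")
    case True
    then have "{..a} \<inter> unit_square = {}" by (auto simp: atMost_prod)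
    then show ?thesis using True by simp
  next
    case False
    then have "{..a} \<inter> unit_square = {0..min 1 (fst a)} \<times> {0..min 1 (snd a)}"
      by (auto simp: atMost_prod)
    then show ?thesis using False cdf_measure_D(3)[OF that, of "min 1 (fst a)" "min 1 (snd a)"] by simp
  qed
  have eq: "distr M borel (\<lambda>z. z) = distr N borel (\<lambda>z. z)"
  proof (rule measure_eqI_atMost)
    show "emeasure (distr M borel (\<lambda>z. z)) UNIV \<noteq> \<infinity>"
      using em[OF M, of UNIV] finite_measure.emeasure_finite[OF M'(4)] by simp
  qed (simp_all add: em[OF M] em[OF N] low[OF M] low[OF N])
  show ?thesis
  proof (rule measure_eqI)
    fix A assume "A \<in> sets M"
    then have "A \<subseteq> unit_square" "A \<in> sets borel" by (auto simp: M'(1) sets_square_iff)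
    then show "emeasure M A = emeasure N A"
      using em[OF M, of A] em[OF N, of A] eq by (simp add: Int_absorb2)
  qed (simp add: M' N')
qed

lemma copulaD:
  assumes "copula C"
  shows "\<And>x y. x \<in> {0..1} \<Longrightarrow> y \<in> {0..1} \<Longrightarrow> 0 \<le> C x y"
    "\<And>x. x \<in> {0..1} \<Longrightarrow> C x 0 = 0" "\<And>x. x \<in> {0..1} \<Longrightarrow> C x 1 = x"
    "\<And>x. x \<in> {0..1} \<Longrightarrow> C 0 x = 0" "\<And>x. x \<in> {0..1} \<Longrightarrow> C 1 x = x"
    "\<And>x u y v. 0 \<le> x \<Longrightarrow> x \<le> u \<Longrightarrow> u \<le> 1 \<Longrightarrow> 0 \<le> y \<Longrightarrow> y \<le> v \<Longrightarrow> v \<le> 1 \<Longrightarrow> rect_vol C x u y v \<ge> 0"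
  using assms by (auto simp: copula_def)

lemma copula_mono_lipschitz1:
  assumes C: "copula C" and "0 \<le> a" "a \<le> b" "b \<le> 1" and y: "y \<in> {0..1}"
  shows "C a y \<le> C b y" "C b y - C a y \<le> b - a"
proof -
  have "a \<in> {0..1}" "b \<in> {0..1}" using assms by auto
  then show "C a y \<le> C b y" "C b y - C a y \<le> b - a"
    using copulaD(6)[OF C, of a b 0 y] copulaD(6)[OF C, of a b y 1] copulaD(2,3)[OF C, of a]
      copulaD(2,3)[OF C, of b] assms by (auto simp: rect_vol_def)
qed

lemma copula_transpose: "copula C \<Longrightarrow> copula (\<lambda>x y. C y x)"
  unfolding copula_def rect_vol_def by (auto simp: algebra_simps)

lemma copula_mono_lipschitz2:
  assumes C: "copula C" and "0 \<le> a" "a \<le> b" "b \<le> 1" and x: "x \<in> {0..1}"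
  shows "C x a \<le> C x b" "C x b - C x a \<le> b - a"
  using copula_mono_lipschitz1[OF copula_transpose[OF C] assms(2-5)] by auto

section \<open>Section densities of a copula\<close>

text \<open>The density of \<open>B \<mapsto> \<mu>\<^sub>C(B \<times> [0,y])\<close>, that is, a version of \<open>t \<mapsto> \<partial>\<^sub>1C(t,y)\<close> that is Borel
and bounded everywhere. Only increments of \<open>C\<close> enter, so that the definition makes sense before
\<open>\<mu>\<^sub>C\<close> is known to exist.\<close>
definition section_density :: "(real \<Rightarrow> real \<Rightarrow> real) \<Rightarrow> real \<Rightarrow> (real \<Rightarrow> real) \<Rightarrow> bool" where
  "section_density C y g \<longleftrightarrow> g \<in> borel_measurable borel \<and> (\<forall>t. 0 \<le> g t \<and> g t \<le> 1) \<and>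
     (\<forall>a b. 0 \<le> a \<longrightarrow> a \<le> b \<longrightarrow> b \<le> 1 \<longrightarrow>
        (\<integral>\<^sup>+t\<in>{a..b}. ennreal (g t) \<partial>lborel) = ennreal (C b y - C a y))"

lemma section_densityD:
  assumes "section_density C y g"
  shows "g \<in> borel_measurable borel" "\<And>t. 0 \<le> g t" "\<And>t. g t \<le> 1"
    "\<And>a b. 0 \<le> a \<Longrightarrow> a \<le> b \<Longrightarrow> b \<le> 1 \<Longrightarrow>
        (\<integral>\<^sup>+t\<in>{a..b}. ennreal (g t) \<partial>lborel) = ennreal (C b y - C a y)"
  using assms unfolding section_density_def by blast+

lemma ex_section_density:
  assumes C: "copula C" and y: "y \<in> {0..1}"
  shows "\<exists>g. section_density C y g"
proof (rule ex_density_of_mono_lipschitz[of "\<lambda>s. C s y"])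
  fix g assume "g \<in> borel_measurable borel" "\<And>t. 0 \<le> g t" "\<And>t. g t \<le> 1"
    "\<And>a b. 0 \<le> a \<Longrightarrow> a \<le> b \<Longrightarrow> b \<le> 1 \<Longrightarrow>
        (\<integral>\<^sup>+t\<in>{a..b}. ennreal (g t) \<partial>lborel) = ennreal (C b y - C a y)"
  then have "section_density C y g" unfolding section_density_def by blast
  then show "\<exists>g. section_density C y g" by blast
qed (fact copula_mono_lipschitz1[OF C _ _ _ y])+

lemma AE_section_density_derivative:
  assumes C: "copula C" and y: "y \<in> {0..1}" and g: "section_density C y g"
  shows "AE t in lborel. t \<in> {0<..<1} \<longrightarrow> ((\<lambda>s. C s y) has_real_derivative g t) (at t)"
proof (rule AE_has_real_derivative_density)
  fix a b :: real assume ab: "0 \<le> a" "a \<le> b" "b \<le> 1"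
  show "C a y \<le> C b y" by (rule copula_mono_lipschitz1(1)[OF C ab y])
  show "(\<integral>\<^sup>+t\<in>{a..b}. ennreal (g t) \<partial>lborel) = ennreal (C b y - C a y)"
    by (rule section_densityD(4)[OF g ab])
qed (rule section_densityD[OF g])+

text \<open>Both sides, as functions of \<open>B\<close>, are finite Borel measures on the line. They agree on the sets
\<open>{..a}\<close>, where the left side is read off from the distribution function and the right side from the
integral of the density.\<close>
lemma emeasure_strip:
  assumes C: "copula C" and M: "cdf_measure C M" and y: "y \<in> {0..1}"
    and g: "section_density C y g"
    and B: "B \<in> sets borel"
  shows "emeasure M ((B \<inter> {0..1}) \<times> {0..y}) = (\<integral>\<^sup>+t\<in>B \<inter> {0..1}. ennreal (g t) \<partial>lborel)"
proof -
  note M' = cdf_measure_D[OF M]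
  note [measurable] = section_densityD(1)[OF g] and int = section_densityD(4)[OF g]
  let ?R = "{0..1} \<times> {0..y}"
  have R: "?R \<in> sets M" using y by (auto simp: M' sets_square_iff)
  have fst[measurable]: "fst \<in> M \<rightarrow>\<^sub>M borel"
    using measurable_compose[OF measurable_id_square[OF M'(1)], of fst borel] by (simp add: borel_prod[symmetric])
  define N1 where "N1 = distr (density M (indicator ?R)) borel fst"
  define N2 where "N2 = density lborel (\<lambda>t. ennreal (g t) * indicator {0..1} t)"
  have N1: "emeasure N1 A = emeasure M ((A \<inter> {0..1}) \<times> {0..y})" if A[measurable]: "A \<in> sets borel" for A
  proof -
    have *: "fst -` A \<inter> space M \<in> sets M" using fst A by (rule measurable_sets)
    have "emeasure N1 A = emeasure (density M (indicator ?R)) (fst -` A \<inter> space M)"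
      unfolding N1_def by (subst emeasure_distr) (auto simp: A)
    also have "\<dots> = emeasure M (?R \<inter> (fst -` A \<inter> space M))"
      using R * by (subst emeasure_density) (simp_all add: indicator_inter_arith[symmetric])
    also have "?R \<inter> (fst -` A \<inter> space M) = (A \<inter> {0..1}) \<times> {0..y}" using y by (auto simp: M')
    finally show ?thesis .
  qed
  have N2: "emeasure N2 A = (\<integral>\<^sup>+t\<in>A \<inter> {0..1}. ennreal (g t) \<partial>lborel)" if A[measurable]: "A \<in> sets borel" for A
    unfolding N2_def
    by (subst emeasure_density) (auto intro!: nn_integral_cong simp: A indicator_def)
  have "N1 = N2"
  proof (rule measure_eqI_atMost)
    show "emeasure N1 {..a} = emeasure N2 {..a}" for a
    proof (cases "a < 0")
      case True
      then have "{..a} \<inter> {0..1} = {}" by auto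
      then show ?thesis by (simp add: N1 N2)
    next
      case False
      then have *: "{..a} \<inter> {0..1} = {0..min a 1}" by auto
      show ?thesis using int[of 0 "min a 1"] False y copulaD(4)[OF C y] M'(3)[of "min a 1" y]
        by (simp add: N1 N2 *)
    qed
    show "emeasure N1 UNIV \<noteq> \<infinity>"
      using M'(3)[of 1 y] y by (simp add: N1)
  qed (simp_all add: N1_def N2_def)
  then show ?thesis using N1[OF B] N2[OF B] by simp
qed

lemma section_density_marginal:
  assumes C: "copula C"
  shows "section_density C 1 (\<lambda>t. 1)"
proof -
  have "(\<integral>\<^sup>+t\<in>{a..b}. ennreal 1 \<partial>lborel) = ennreal (C b 1 - C a 1)"
    if "0 \<le> a" "a \<le> b" "b \<le> 1" for a b
    using copulaD(3)[OF C, of a] copulaD(3)[OF C, of b] that by simp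
  then show ?thesis by (simp add: section_density_def)
qed

lemma emeasure_first_marginal:
  assumes C: "copula C" and M: "cdf_measure C M" and B: "B \<in> sets borel" "B \<subseteq> {0..1}"
  shows "emeasure M (B \<times> {0..1}) = emeasure lborel B"
proof -
  have "emeasure M ((B \<inter> {0..1}) \<times> {0..1}) = (\<integral>\<^sup>+t\<in>B \<inter> {0..1}. ennreal 1 \<partial>lborel)"
    by (rule emeasure_strip[OF C M _ section_density_marginal[OF C] B(1)]) simp
  moreover have "B \<inter> {0..1} = B" using B by auto
  ultimately show ?thesis using B by simp
qed

lemma measurable_swap_square:
  assumes "sets M = sets (restrict_space borel unit_square)"
  shows "prod.swap \<in> M \<rightarrow>\<^sub>M restrict_space borel unit_square"
proof (rule measurable_restrict_space2)
  have "prod.swap \<in> borel \<rightarrow>\<^sub>M (borel :: (real \<times> real) measure)"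
    by (intro borel_measurable_continuous_onI continuous_on_swap)
  then show "prod.swap \<in> M \<rightarrow>\<^sub>M borel"
    by (rule measurable_compose[OF measurable_id_square[OF assms]])
qed (auto simp: space_square[OF assms])

lemma cdf_measure_transpose:
  assumes M: "cdf_measure C M"
  shows "cdf_measure (\<lambda>x y. C y x) (distr M (restrict_space borel unit_square) prod.swap)"
proof -
  note M' = cdf_measure_D[OF M]
  note m = measurable_swap_square[OF M'(1)]
  show ?thesis
    unfolding cdf_measure_def
  proof (intro conjI ballI)
    fix x y :: real assume xy: "x \<in> {0..1}" "y \<in> {0..1}"
    have "prod.swap -` ({0..x} \<times> {0..y}) \<inter> space M = {0..y} \<times> {0..x}" using xy by (auto simp: M')
    then show "emeasure (distr M (restrict_space borel unit_square) prod.swap) ({0..x} \<times> {0..y}) = ennreal (C y x)"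
      using xy M'(3)[of y x] by (subst emeasure_distr[OF m]) (auto simp: sets_square_iff)
  qed simp
qed

section \<open>The measure of a copula\<close>

text \<open>Lines parallel to the axes are null because the marginals are uniform. This makes closed and half-open
rectangles interchangeable.\<close>
lemma null_vertical_line:
  assumes C: "copula C" and M: "cdf_measure C M" and x: "x \<in> {0..1}"
  shows "{x} \<times> {0..1} \<in> null_sets M"
proof
  show "{x} \<times> {0..1} \<in> sets M" using x by (auto simp: cdf_measure_D[OF M] sets_square_iff)
  show "emeasure M ({x} \<times> {0..1}) = 0" using x by (subst emeasure_first_marginal[OF C M]) auto
qed

lemma null_horizontal_line:
  assumes C: "copula C" and M: "cdf_measure C M" and y: "y \<in> {0..1}"
  shows "{0..1} \<times> {y} \<in> null_sets M"
proof -
  note M' = cdf_measure_D[OF M]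
  let ?N = "distr M (restrict_space borel unit_square) prod.swap"
  note m = measurable_swap_square[OF M'(1)]
  have "{y} \<times> {0..1} \<in> null_sets ?N"
    by (rule null_vertical_line[OF copula_transpose[OF C] cdf_measure_transpose[OF M] y])
  moreover have "prod.swap -` ({y} \<times> {0..1}) \<inter> space M = {0..1} \<times> {y}" using y by (auto simp: M')
  ultimately show ?thesis using null_sets_distr_iff[OF m, of "{y} \<times> {0..1}"] by simp
qed

text \<open>Inclusion and exclusion give the mass of the half-open rectangle \<open>]x,u] \<times> ]y,v]\<close>, written as a
difference of rectangles with a corner at the origin.\<close>
lemma measure_rect_Diff:
  assumes fin: "finite_measure M" and sets: "sets M = sets (restrict_space borel unit_square)"
    and xu: "0 \<le> x" "x \<le> u" "u \<le> 1" and yv: "0 \<le> y" "y \<le> v" "v \<le> 1"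
  shows "measure M ({0..u} \<times> {0..v} - ({0..x} \<times> {0..v} \<union> {0..u} \<times> {0..y}))
    = rect_vol (\<lambda>x y. measure M ({0..x} \<times> {0..y})) x u y v"
proof -
  interpret finite_measure M by fact
  have S: "{0..a} \<times> {0..b} \<in> sets M" if "a \<le> 1" "b \<le> 1" for a b
    using that by (auto simp: sets sets_square_iff)
  have i: "{0..x} \<times> {0..v} \<inter> {0..u} \<times> {0..y} = {0..x} \<times> {0..y}" using xu yv by auto
  have "measure M ({0..x} \<times> {0..v} \<union> {0..u} \<times> {0..y})
      = measure M ({0..x} \<times> {0..v}) + measure M ({0..u} \<times> {0..y}) - measure M ({0..x} \<times> {0..y})"
    unfolding i[symmetric] using S xu yv by (intro measure_Un3) (auto simp: fmeasurable_eq_sets)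
  moreover have "measure M ({0..u} \<times> {0..v} - ({0..x} \<times> {0..v} \<union> {0..u} \<times> {0..y}))
     = measure M ({0..u} \<times> {0..v}) - measure M ({0..x} \<times> {0..v} \<union> {0..u} \<times> {0..y})"
    using S xu yv by (intro finite_measure_Diff sets.Un) auto
  ultimately show ?thesis by (simp add: rect_vol_def)
qed

lemma emeasure_rect:
  assumes C: "copula C" and M: "cdf_measure C M"
    and xu: "0 \<le> x" "x \<le> u" "u \<le> 1" and yv: "0 \<le> y" "y \<le> v" "v \<le> 1"
  shows "emeasure M ({x..u} \<times> {y..v}) = ennreal (rect_vol C x u y v)"
proof -
  note M' = cdf_measure_D[OF M]
  interpret finite_measure M by (rule M')
  let ?D = "{0..u} \<times> {0..v} - ({0..x} \<times> {0..v} \<union> {0..u} \<times> {0..y})"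
  have m: "measure M ({0..a} \<times> {0..b}) = C a b" if "a \<in> {0..1}" "b \<in> {0..1}" for a b
    using M'(3)[OF that] copulaD(1)[OF C that] by (simp add: measure_def)
  have "{x} \<times> {0..1} \<in> null_sets M" "{0..1} \<times> {y} \<in> null_sets M"
    using null_vertical_line[OF C M, of x] null_horizontal_line[OF C M, of y] xu yv by auto
  then have "AE z in M. z \<notin> {x} \<times> {0..1} \<and> z \<notin> {0..1} \<times> {y}" by (auto dest: AE_not_in)
  then have "AE z in M. z \<in> {x..u} \<times> {y..v} \<longleftrightarrow> z \<in> ?D"
    using AE_space
  proof eventually_elim
    case (elim z)
    obtain z1 z2 where z: "z = (z1, z2)" by (cases z)
    from elim have "0 \<le> z1" "z1 \<le> 1" "0 \<le> z2" "z2 \<le> 1" "z1 \<noteq> x" "z2 \<noteq> y"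
      by (auto simp: z M')
    then show ?case using xu yv by (auto simp: z)
  qed
  then have "emeasure M ({x..u} \<times> {y..v}) = emeasure M ?D"
    using xu yv by (intro emeasure_eq_AE) (auto simp: M' sets_square_iff intro!: sets.Diff)
  also have "\<dots> = ennreal (rect_vol C x u y v)"
    using measure_rect_Diff[OF finite_measure_axioms M'(1) xu yv] xu yv
    by (simp add: emeasure_eq_measure rect_vol_def m)
  finally show ?thesis .
qed

lemma copula_measure_eqI:
  assumes C: "copula C" and M: "cdf_measure C M"
  shows "copula_measure C = M"
  unfolding copula_measure_def
proof (rule the_equality)
  show "sets M = sets (restrict_space borel unit_square) \<and>
     (\<forall>x\<in>{0..1}. \<forall>u\<in>{0..1}. \<forall>y\<in>{0..1}. \<forall>v\<in>{0..1}. x \<le> u \<longrightarrow> y \<le> v \<longrightarrow>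
        emeasure M ({x..u} \<times> {y..v}) = ennreal (rect_vol C x u y v))"
    using cdf_measure_D(1)[OF M] emeasure_rect[OF C M] by auto
next
  fix N assume N: "sets N = sets (restrict_space borel unit_square) \<and>
     (\<forall>x\<in>{0..1}. \<forall>u\<in>{0..1}. \<forall>y\<in>{0..1}. \<forall>v\<in>{0..1}. x \<le> u \<longrightarrow> y \<le> v \<longrightarrow>
        emeasure N ({x..u} \<times> {y..v}) = ennreal (rect_vol C x u y v))"
  have "cdf_measure C N"
    unfolding cdf_measure_def
  proof (intro conjI ballI)
    fix x y :: real assume xy: "x \<in> {0..1}" "y \<in> {0..1}"
    have "rect_vol C 0 x 0 y = C x y"
      using copulaD(2)[OF C xy(1)] copulaD(4)[OF C xy(2)] copulaD(2)[OF C, of 0] by (simp add: rect_vol_def)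
    then show "emeasure N ({0..x} \<times> {0..y}) = ennreal (C x y)" using N xy by auto
  qed (use N in blast)
  then show "N = M" using M by (rule cdf_measure_unique)
qed

lemma copula_of_uniform_marginals:
  assumes sets: "sets M = sets (restrict_space borel unit_square)"
    and m1: "\<And>x. x \<in> {0..1} \<Longrightarrow> emeasure M ({0..x} \<times> {0..1}) = ennreal x"
    and m2: "\<And>y. y \<in> {0..1} \<Longrightarrow> emeasure M ({0..1} \<times> {0..y}) = ennreal y"
  defines "F \<equiv> \<lambda>x y. measure M ({0..x} \<times> {0..y})"
  shows "copula F" "cdf_measure F M"
proof -
  have sp: "space M = unit_square" by (rule space_square[OF sets])
  interpret finite_measure M by (rule finite_measureI) (simp add: sp m1)
  have S: "{0..a} \<times> {0..b} \<in> sets M" if "a \<le> 1" "b \<le> 1" for a b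
    using that by (auto simp: sets sets_square_iff)
  have F1: "F x 1 = x" if "x \<in> {0..1}" for x using m1[OF that] that by (simp add: F_def measure_def)
  have F2: "F 1 x = x" if "x \<in> {0..1}" for x using m2[OF that] that by (simp add: F_def measure_def)
  have Fmono: "F a b \<le> F c d" if "a \<le> c" "b \<le> d" "c \<le> 1" "d \<le> 1" for a b c d
    unfolding F_def using that by (intro finite_measure_mono S) auto
  have F0: "0 \<le> F a b" for a b by (simp add: F_def)
  show "copula F"
    unfolding copula_def
  proof (intro conjI ballI impI)
    fix u v :: real assume uv: "u \<in> {0..1}" "v \<in> {0..1}"
    show "F u v \<in> {0..1}" using Fmono[of u 1 v 1] F1[of 1] uv F0[of u v] by simp
  next
    fix u :: real assume u: "u \<in> {0..1}"
    show "F u 0 = 0" using Fmono[of u 1 0 0] F2[of 0] F0[of u 0] u by simp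
    show "F u 1 = u" "F 1 u = u" using F1 F2 u by auto
    show "F 0 u = 0" using Fmono[of 0 0 u 1] F1[of 0] F0[of 0 u] u by simp
  next
    fix x u y v :: real
    assume "x \<in> {0..1}" "u \<in> {0..1}" "y \<in> {0..1}" "v \<in> {0..1}" "x \<le> u" "y \<le> v"
    then show "0 \<le> rect_vol F x u y v"
      using measure_rect_Diff[OF finite_measure_axioms sets, of x u y v] unfolding F_def
      by (metis atLeastAtMost_iff measure_nonneg)
  qed
  show "cdf_measure F M"
    by (auto simp: cdf_measure_def sets F_def emeasure_eq_measure)
qed

text \<open>Let \<open>g q\<close> be a section density at height \<open>q\<close>. For almost every \<open>t\<close> it is nondecreasing in
rational \<open>q\<close>, since it is the derivative of \<open>C(\<cdot>,q)\<close> and the differences \<open>C(\<cdot>,r) - C(\<cdot>,q)\<close> are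
nondecreasing for \<open>q \<le> r\<close>. Put \<open>Q t s = inf {q. s \<le> g q t}\<close> over rational \<open>q\<close> and take the
image of Lebesgue measure on the square under \<open>(t,s) \<mapsto> (t, Q t s)\<close>. The event \<open>Q t s \<le> y\<close>
contains \<open>s \<le> g q t\<close> for \<open>q \<le> y\<close> and is contained in \<open>s \<le> g r t\<close> for \<open>r > y\<close>. So the mass
of \<open>[0,x] \<times> [0,y]\<close> lies between \<open>C(x,q)\<close> and \<open>C(x,r)\<close>, and continuity of \<open>C(x,\<cdot>)\<close> identifies
it. Quantiles avoid having to correct the family \<open>g\<close> to genuine distribution functions.\<close>
lemma ex_cdf_measure:
  assumes C: "copula C"
  shows "\<exists>M. cdf_measure C M"
proof -
  have "\<forall>y\<in>{0..1}. \<exists>g. section_density C y g" using ex_section_density[OF C] by blast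
  from bchoice[OF this] obtain g where g: "\<forall>y\<in>{0..1}. section_density C y (g y)" by blast
  then have g: "section_density C y (g y)" if "y \<in> {0..1}" for y using that by blast
  note gm = section_densityD(1)[OF g] and g0 = section_densityD(2)[OF g] and g1 = section_densityD(3)[OF g]
    and int = section_densityD(4)[OF g] and der = AE_section_density_derivative[OF C _ g]
  have gmono: "AE t in lborel. t \<in> {0<..<1} \<longrightarrow> g q t \<le> g r t"
    if qr: "q \<in> {0..1}" "r \<in> {0..1}" "q \<le> r" for q r
    using der[OF qr(1) qr(1)] der[OF qr(2) qr(2)]
  proof eventually_elim
    case (elim t)
    show ?case
    proof
      assume t: "t \<in> {0<..<1}"
      have d: "((\<lambda>s. C s r - C s q) has_real_derivative (g r t - g q t)) (at t)"
        using elim t by (intro derivative_intros) auto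
      have "mono_on {0..1} (\<lambda>s. C s r - C s q)"
      proof (rule mono_onI)
        fix a b :: real assume "a \<in> {0..1}" "b \<in> {0..1}" "a \<le> b"
        then show "C a r - C a q \<le> C b r - C b q"
          using copulaD(6)[OF C, of a b q r] qr by (simp add: rect_vol_def)
      qed
      from mono_on_imp_deriv_nonneg[OF this d] t have "0 \<le> g r t - g q t" by simp
      then show "g q t \<le> g r t" by simp
    qed
  qed
  define Qs where "Qs = \<rat> \<inter> {0..1::real}"
  have Qs: "countable Qs" "Qs \<subseteq> {0..1}" "0 \<in> Qs" by (auto simp: Qs_def countable_rat)
  \<comment> \<open>The value 1 stands for the missing \<open>q\<close>: it keeps the infimum inside the unit interval
    and does not change the events \<open>Q t s < r\<close> with \<open>r \<le> 1\<close>.\<close>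
  define Q where "Q t s = (INF q\<in>Qs. if s \<le> g q t then q else 1)" for t s
  have bdd: "bdd_below ((\<lambda>q. if s \<le> g q t then q else 1) ` Qs)" for t s
    using Qs(2) by (intro bdd_belowI[of _ 0]) auto
  have Q0: "0 \<le> Q t s" for t s
    unfolding Q_def using Qs by (intro cINF_greatest) auto
  have Qle: "Q t s \<le> (if s \<le> g q t then q else 1)" if "q \<in> Qs" for t s q
    unfolding Q_def using that by (intro cINF_lower bdd)
  have Q1: "Q t s \<le> 1" for t s
    using Qle[OF Qs(3), of t s] by (auto split: if_splits)
  have Qless: "\<exists>q\<in>Qs. q < r \<and> s \<le> g q t" if "Q t s < r" "r \<le> 1" for t s r
  proof -
    have "\<exists>q\<in>Qs. (if s \<le> g q t then q else 1) < r"
      using Qs(3) by (intro iffD1[OF cINF_less_iff[OF _ bdd] that(1)[unfolded Q_def]]) auto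
    then show ?thesis using that(2) by (auto split: if_splits)
  qed
  have gm2[measurable]: "(\<lambda>z. g q (fst z)) \<in> borel_measurable (lborel \<Otimes>\<^sub>M lborel)" if "q \<in> Qs" for q
    using gm[of q] Qs(2) that by (auto intro!: measurable_compose[OF measurable_fst])
  have Qm: "(\<lambda>z. Q (fst z) (snd z)) \<in> borel_measurable (lborel \<Otimes>\<^sub>M lborel)"
    unfolding Q_def
  proof (rule borel_measurable_cINF[OF Qs(1)])
    fix q assume [measurable]: "q \<in> Qs"
    show "(\<lambda>z. if snd z \<le> g q (fst z) then q else 1) \<in> borel_measurable (lborel \<Otimes>\<^sub>M lborel)" by measurable
  qed (rule bdd)
  let ?L = "restrict_space (lborel :: (real \<times> real) measure) unit_square"
  define \<phi> where "\<phi> z = (fst z, Q (fst z) (snd z))" for z :: "real \<times> real"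
  have \<phi>: "\<phi> \<in> ?L \<rightarrow>\<^sub>M restrict_space borel unit_square"
  proof (rule measurable_restrict_space2)
    show "\<phi> \<in> space ?L \<rightarrow> unit_square" using Q0 Q1 by (auto simp: \<phi>_def space_restrict_space)
    have "\<phi> \<in> lborel \<Otimes>\<^sub>M lborel \<rightarrow>\<^sub>M borel"
      unfolding \<phi>_def using Qm by (simp add: borel_prod[symmetric])
    then show "\<phi> \<in> ?L \<rightarrow>\<^sub>M borel" by (intro measurable_restrict_space1) (simp add: lborel_prod)
  qed
  define M where "M = distr ?L (restrict_space borel unit_square) \<phi>"
  have "emeasure M ({0..x} \<times> {0..y}) = ennreal (C x y)" if x: "x \<in> {0..1}" and y: "y \<in> {0..1}" for x y
  proof -
    define S where "S = {z \<in> unit_square. fst z \<le> x \<and> Q (fst z) (snd z) \<le> y}"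
    have Seq: "S = {z \<in> space (lborel \<Otimes>\<^sub>M lborel). fst z \<in> {0..1} \<and> snd z \<in> {0..1} \<and> fst z \<le> x \<and> Q (fst z) (snd z) \<le> y}"
      by (auto simp: S_def space_pair_measure)
    have S[measurable]: "S \<in> sets (lborel \<Otimes>\<^sub>M lborel)"
      unfolding Seq using Qm by measurable
    have "emeasure M ({0..x} \<times> {0..y}) = emeasure ?L (\<phi> -` ({0..x} \<times> {0..y}) \<inter> space ?L)"
      unfolding M_def using x y by (intro emeasure_distr[OF \<phi>]) (auto simp: sets_square_iff)
    also have "\<phi> -` ({0..x} \<times> {0..y}) \<inter> space ?L = S"
      using Q0 by (auto simp: \<phi>_def S_def space_restrict_space)
    also have "emeasure ?L S = emeasure lborel S"
      by (rule emeasure_restrict_space) (auto simp: S_def)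
    also have "\<dots> = (\<integral>\<^sup>+t. emeasure lborel (Pair t -` S) \<partial>lborel)"
      using lborel.emeasure_pair_measure_alt[OF S] by (simp add: lborel_prod)
    finally have MS: "emeasure M ({0..x} \<times> {0..y}) = (\<integral>\<^sup>+t. emeasure lborel (Pair t -` S) \<partial>lborel)" .
    have sec[measurable]: "Pair t -` S \<in> sets lborel" for t using S by (rule sets_Pair1)
    have lower: "ennreal (C x q) \<le> emeasure M ({0..x} \<times> {0..y})" if q: "q \<in> Qs" "q \<le> y" for q
    proof -
      have q': "q \<in> {0..1}" using q Qs by auto
      have "ennreal (C x q) = (\<integral>\<^sup>+t\<in>{0..x}. ennreal (g q t) \<partial>lborel)"
        using int[OF q', of 0 x] x copulaD(4)[OF C q'] by simp
      also have "\<dots> \<le> emeasure M ({0..x} \<times> {0..y})"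
        unfolding MS
      proof (rule nn_integral_mono)
        fix t
        show "ennreal (g q t) * indicator {0..x} t \<le> emeasure lborel (Pair t -` S)"
        proof (cases "t \<in> {0..x}")
          case True
          have "{0..g q t} \<subseteq> Pair t -` S"
            using True x g1[OF q', of t] order_trans[OF Qle[OF q(1)], of _ t y] q(2) by (auto simp: S_def)
          from emeasure_mono[OF this sec] show ?thesis using True g0[OF q', of t] by simp
        qed simp
      qed
      finally show ?thesis .
    qed
    have upper: "emeasure M ({0..x} \<times> {0..y}) \<le> ennreal (C x r)" if r: "r \<in> Qs" "y < r" for r
    proof -
      have r': "r \<in> {0..1}" using r Qs by auto
      have "AE t in lborel. \<forall>q\<in>Qs. q \<le> r \<longrightarrow> t \<in> {0<..<1} \<longrightarrow> g q t \<le> g r t"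
        using Qs gmono[OF _ r'] by (intro AE_ball_countable') auto
      moreover have "AE t in lborel. t \<noteq> (0::real)" "AE t in lborel. t \<noteq> (1::real)"
        by (rule AE_lborel_singleton)+
      ultimately have "AE t in lborel. emeasure lborel (Pair t -` S) \<le> ennreal (g r t) * indicator {0..x} t"
      proof eventually_elim
        case (elim t)
        show ?case
        proof (cases "t \<in> {0..x}")
          case True
          then have t: "t \<in> {0<..<1}" using elim x by auto
          have "Pair t -` S \<subseteq> {0..g r t}"
          proof
            fix s assume "s \<in> Pair t -` S"
            then have s: "0 \<le> s" "Q t s < r" using r by (auto simp: S_def)
            then obtain q where "q \<in> Qs" "q < r" "s \<le> g q t" using Qless[of t s r] r' by auto
            then show "s \<in> {0..g r t}" using elim(1) t s by force
          qed
          from emeasure_mono[OF this, of lborel] show ?thesis using True g0[OF r', of t] by simp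
        next
          case False
          then have "Pair t -` S = {}" by (auto simp: S_def)
          then show ?thesis by simp
        qed
      qed
      then have "emeasure M ({0..x} \<times> {0..y}) \<le> (\<integral>\<^sup>+t\<in>{0..x}. ennreal (g r t) \<partial>lborel)"
        unfolding MS by (rule nn_integral_mono_AE)
      also have "\<dots> = ennreal (C x r)" using int[OF r', of 0 x] x copulaD(4)[OF C r'] by simp
      finally show ?thesis .
    qed
    \<comment> \<open>For \<open>y = 1\<close> no \<open>r > y\<close> is available, but the whole strip has mass \<open>x\<close>.\<close>
    have upper1: "emeasure M ({0..x} \<times> {0..y}) \<le> ennreal x"
    proof -
      have "(\<integral>\<^sup>+t. emeasure lborel (Pair t -` S) \<partial>lborel) \<le> (\<integral>\<^sup>+t. indicator {0..x} t \<partial>lborel)"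
      proof (rule nn_integral_mono)
        fix t
        have "Pair t -` S \<subseteq> (if t \<in> {0..x} then {0..1} else {})" by (auto simp: S_def)
        from emeasure_mono[OF this, of lborel] show "emeasure lborel (Pair t -` S) \<le> indicator {0..x} t"
          by (auto split: if_splits)
      qed
      then show ?thesis using MS x by simp
    qed
    then obtain m where m: "emeasure M ({0..x} \<times> {0..y}) = ennreal m" "0 \<le> m"
      by (cases "emeasure M ({0..x} \<times> {0..y})") (auto simp: top_unique)
    have "C x y \<le> m"
    proof (rule field_le_epsilon)
      fix e :: real assume e: "e > 0"
      obtain q where q: "q \<in> Qs" "q \<le> y" "y - q \<le> e"
      proof (cases "y = 0")
        case True
        then show ?thesis using that[of 0] Qs e by auto
      next
        case False
        then have "max 0 (y - e) < y" using y e by auto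
        then obtain q where "q \<in> \<rat>" "max 0 (y - e) < q" "q < y" using Rats_dense_in_real by blast
        then show ?thesis using that[of q] y by (auto simp: Qs_def)
      qed
      have "C x q \<le> m" using lower[OF q(1,2)] m by simp
      moreover have "C x y - C x q \<le> y - q"
        using q Qs y x by (intro copula_mono_lipschitz2[OF C]) auto
      ultimately show "C x y \<le> m + e" using q by simp
    qed
    moreover have "m \<le> C x y"
    proof (cases "y = 1")
      case True
      then show ?thesis using upper1 m copulaD(3)[OF C x] x by simp
    next
      case False
      show ?thesis
      proof (rule field_le_epsilon)
        fix e :: real assume e: "e > 0"
        have "y < min 1 (y + e)" using y e False by auto
        then obtain r where r: "r \<in> \<rat>" "y < r" "r < min 1 (y + e)" using Rats_dense_in_real by blast
        have r': "r \<in> Qs" using r y by (auto simp: Qs_def)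
        have "m \<le> C x r" using upper[OF r' r(2)] m copulaD(1)[OF C x, of r] r' Qs by auto
        moreover have "C x r - C x y \<le> r - y"
          using r y x by (intro copula_mono_lipschitz2[OF C]) auto
        ultimately show "m \<le> C x y + e" using r by simp
      qed
    qed
    ultimately show ?thesis using m by simp
  qed
  then have "cdf_measure C M" by (auto simp: cdf_measure_def M_def)
  then show ?thesis ..
qed

lemma cdf_measure_copula_measure: "copula C \<Longrightarrow> cdf_measure C (copula_measure C)"
  using ex_cdf_measure copula_measure_eqI by metis

section \<open>Push-forward in the first coordinate\<close>

text \<open>Replacing \<open>T\<close> by \<open>S\<close> turns the push-forward from the completion of a copula measure into an
ordinary image measure, because null sets of the line give null strips of the square.\<close>
definition borel_version :: "(real \<Rightarrow> real) \<Rightarrow> (real \<Rightarrow> real) \<Rightarrow> bool" where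
  "borel_version T S \<longleftrightarrow> T \<in> {0..1} \<rightarrow> {0..1} \<and> S \<in> borel_measurable borel \<and> range S \<subseteq> {0..1} \<and>
     (AE t in lborel. t \<in> {0..1} \<longrightarrow> T t = S t)"

lemma borel_versionD:
  assumes "borel_version T S"
  shows "\<And>t. t \<in> {0..1} \<Longrightarrow> T t \<in> {0..1}" "S \<in> borel_measurable borel" "\<And>t. S t \<in> {0..1}"
    "AE t in lborel. t \<in> {0..1} \<longrightarrow> T t = S t"
    "\<And>x. S -` {0..x} \<inter> {0..1} \<in> sets borel"
proof -
  show S: "S \<in> borel_measurable borel" using assms by (simp add: borel_version_def)
  show "S -` {0..x} \<inter> {0..1} \<in> sets borel" for x
    using measurable_sets_borel[OF S, of "{0..x}"] by (intro sets.Int) auto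
qed (use assms in \<open>unfold borel_version_def, blast+\<close>)

lemma measure_preserving_borel_version:
  assumes T: "measure_preserving T"
  obtains S where "borel_version T S"
    "\<And>x. x \<in> {0..1} \<Longrightarrow> emeasure lborel (S -` {0..x} \<inter> {0..1}) = ennreal x"
proof -
  let ?L = "lebesgue_on {0..1::real}"
  have Tm: "T \<in> measurable ?L ?L"
    and Tp: "\<And>B. B \<in> sets ?L \<Longrightarrow> emeasure ?L (T -` B \<inter> {0..1}) = emeasure ?L B"
    using T by (auto simp: measure_preserving_def)
  have T01: "T t \<in> {0..1}" if "t \<in> {0..1}" for t
    using measurable_space[OF Tm, of t] that by (simp add: space_restrict_space)
  have "(\<lambda>t. t) \<in> borel_measurable ?L"
    by (intro measurable_restrict_space1 measurable_completion) simp
  from measurable_compose[OF Tm this] have "T \<in> borel_measurable ?L" by simp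
  then have "(\<lambda>t. indicator {0..1} t *\<^sub>R T t) \<in> borel_measurable lebesgue"
    by (subst (asm) borel_measurable_restrict_space_iff) auto
  from completion_ex_borel_measurable_real[OF this] obtain U where
    U: "U \<in> borel_measurable lborel" "AE t in lborel. indicator {0..1} t *\<^sub>R T t = U t" by blast
  define S where "S t = max 0 (min 1 (U t))" for t
  have Sm[measurable]: "S \<in> borel_measurable borel" unfolding S_def using U(1) by simp
  have TS: "AE t in lborel. t \<in> {0..1} \<longrightarrow> T t = S t"
    using U(2)
  proof eventually_elim
    case (elim t)
    show ?case
    proof
      assume t: "t \<in> {0..1}"
      then have "T t = U t" using elim by simp
      then show "T t = S t" using T01[OF t] by (simp add: S_def)
    qed
  qed
  show ?thesis
  proof (rule that)
    show "borel_version T S"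
      using T01 Sm TS by (auto simp: borel_version_def S_def)
    fix x :: real assume x: "x \<in> {0..1}"
    have B: "{0..x} \<in> sets ?L" using x by (auto simp: sets_restrict_space_iff)
    have *: "T -` {0..x} \<inter> {0..1} \<in> sets lebesgue"
      using measurable_sets[OF Tm B] by (auto simp: space_restrict_space sets_restrict_space_iff)
    have "emeasure lborel (S -` {0..x} \<inter> {0..1}) = emeasure lebesgue (S -` {0..x} \<inter> {0..1})"
      using measurable_sets_borel[OF Sm, of "{0..x}"] by simp
    also have "\<dots> = emeasure lebesgue (T -` {0..x} \<inter> {0..1})"
    proof (rule emeasure_eq_AE)
      show "AE t in lebesgue. (t \<in> S -` {0..x} \<inter> {0..1}) = (t \<in> T -` {0..x} \<inter> {0..1})"
        using TS by (auto simp: AE_completion_iff elim: eventually_mono)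
    qed (use * measurable_sets_borel[OF Sm] in auto)
    also have "\<dots> = emeasure ?L (T -` {0..x} \<inter> {0..1})"
      by (simp add: emeasure_restrict_space)
    also have "\<dots> = emeasure ?L {0..x}" by (rule Tp[OF B])
    also have "\<dots> = ennreal x" using x by (simp add: emeasure_restrict_space)
    finally show "emeasure lborel (S -` {0..x} \<inter> {0..1}) = ennreal x" .
  qed
qed

text \<open>The preimages under \<open>f\<close> and \<open>g\<close> differ by a subset of a null set, and the completion contains all
of these.\<close>
lemma measurable_completion_AE_eq:
  assumes g: "g \<in> M \<rightarrow>\<^sub>M N" and eq: "AE x in M. f x = g x" and f: "f \<in> space M \<rightarrow> space N"
  shows "f \<in> completion M \<rightarrow>\<^sub>M N"
proof (rule measurableI)
  fix A assume A: "A \<in> sets N"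
  obtain Z where Z: "Z \<in> null_sets M" "\<And>x. x \<in> space M - Z \<Longrightarrow> f x = g x"
    using AE_E3[OF eq] by blast
  have "f -` A \<inter> space M = (g -` A \<inter> space M - Z) \<union> (f -` A \<inter> space M \<inter> Z)"
    using Z(2) by auto
  moreover have "f -` A \<inter> space M \<inter> Z \<in> null_sets (completion M)"
    using Z(1) null_sets_completion_iff2 by blast
  moreover have "g -` A \<inter> space M - Z \<in> sets (completion M)"
    using measurable_sets[OF g A] Z(1) by auto
  ultimately show "f -` A \<inter> space (completion M) \<in> sets (completion M)"
    by (metis null_setsD2 sets.Un space_completion)
qed (use f in auto)

lemma push_fst_borel_version:
  assumes D: "copula D" and M: "cdf_measure D M"
    and TS: "borel_version T S"
  shows "push_fst T M = distr M (restrict_space borel unit_square) (\<lambda>(u, v). (S u, v))"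
    and "(\<lambda>(u, v). (S u, v)) \<in> M \<rightarrow>\<^sub>M restrict_space borel unit_square"
proof -
  note S = borel_versionD(2)[OF TS] and S01 = borel_versionD(3)[OF TS]
  note M' = cdf_measure_D[OF M]
  have "(\<lambda>(u, v). (S u, v)) \<in> borel \<rightarrow>\<^sub>M (borel :: (real \<times> real) measure)"
    unfolding borel_prod[symmetric] using S by measurable
  from measurable_compose[OF measurable_id_square[OF M'(1)] this]
  show Sm: "(\<lambda>(u, v). (S u, v)) \<in> M \<rightarrow>\<^sub>M restrict_space borel unit_square"
    by (intro measurable_restrict_space2) (use S01 in \<open>auto simp: M'\<close>)
  obtain Z where Z: "Z \<in> null_sets lborel" "\<And>t. t \<notin> Z \<Longrightarrow> t \<in> {0..1} \<longrightarrow> T t = S t"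
    using AE_E3[OF borel_versionD(4)[OF TS]] by auto
  have Zb: "Z \<inter> {0..1} \<in> sets borel" "emeasure lborel (Z \<inter> {0..1}) = 0"
    using Z(1) by (auto intro: emeasure_eq_0[of Z])
  have "(Z \<inter> {0..1}) \<times> {0..1} \<in> null_sets M"
  proof
    show "(Z \<inter> {0..1}) \<times> {0..1} \<in> sets M" using Zb(1) by (auto simp: M' sets_square_iff)
    show "emeasure M ((Z \<inter> {0..1}) \<times> {0..1}) = 0"
      using Zb by (subst emeasure_first_marginal[OF D M]) auto
  qed
  then have "AE z in M. z \<notin> (Z \<inter> {0..1}) \<times> {0..1}" by (rule AE_not_in)
  then have AE: "AE z in M. (case z of (u, v) \<Rightarrow> (T u, v)) = (case z of (u, v) \<Rightarrow> (S u, v))"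
    using AE_space by eventually_elim (use Z(2) in \<open>auto simp: M'\<close>)
  have "(\<lambda>(u, v). (T u, v)) \<in> completion M \<rightarrow>\<^sub>M restrict_space borel unit_square"
    by (rule measurable_completion_AE_eq[OF Sm AE]) (use borel_versionD(1)[OF TS] in \<open>auto simp: M' space_restrict_space\<close>)
  then have "push_fst T M = distr (completion M) (restrict_space borel unit_square) (\<lambda>(u, v). (S u, v))"
    unfolding push_fst_def using AE Sm
    by (intro distr_cong_AE) (auto intro: measurable_completion simp: AE_completion_iff)
  then show "push_fst T M = distr M (restrict_space borel unit_square) (\<lambda>(u, v). (S u, v))"
    by (simp add: distr_completion[OF Sm])
qed

text \<open>The preimage of \<open>[0,x] \<times> [0,y]\<close> is again a strip over \<open>[0,y]\<close>, so its mass is an integral of the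
section density.\<close>
lemma emeasure_push_fst:
  assumes D: "copula D" and M: "cdf_measure D M"
    and TS: "borel_version T S"
    and x: "x \<in> {0..1}" and y: "y \<in> {0..1}" and g: "section_density D y g"
  shows "emeasure (push_fst T M) ({0..x} \<times> {0..y}) =
    (\<integral>\<^sup>+t\<in>S -` {0..x} \<inter> {0..1}. ennreal (g t) \<partial>lborel)"
proof -
  note P = push_fst_borel_version[OF D M TS]
  have "(\<lambda>(u, v). (S u, v)) -` ({0..x} \<times> {0..y}) \<inter> space M = (S -` {0..x} \<inter> {0..1}) \<times> {0..y}"
    using y by (auto simp: cdf_measure_D[OF M])
  then have "emeasure (push_fst T M) ({0..x} \<times> {0..y}) = emeasure M ((S -` {0..x} \<inter> {0..1}) \<times> {0..y})"
    using x y P(2) unfolding P(1) by (subst emeasure_distr) (auto simp: sets_square_iff)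
  also have "\<dots> = (\<integral>\<^sup>+t\<in>S -` {0..x} \<inter> {0..1}. ennreal (g t) \<partial>lborel)"
    using emeasure_strip[OF D M y g borel_versionD(5)[OF TS]] by simp
  finally show ?thesis .
qed

text \<open>Preservation of Lebesgue measure keeps the first marginal uniform, and the second coordinate is not
moved. A measure on the square with uniform marginals has a copula as its distribution function.\<close>
lemma push_fst_cdf:
  assumes D: "copula D" and M: "cdf_measure D M" and T: "measure_preserving T"
  defines "F \<equiv> \<lambda>x y. measure (push_fst T M) ({0..x} \<times> {0..y})"
  shows "copula F" "cdf_measure F (push_fst T M)"
proof -
  obtain S where S: "borel_version T S"
    "\<And>x. x \<in> {0..1} \<Longrightarrow> emeasure lborel (S -` {0..x} \<inter> {0..1}) = ennreal x"
    using measure_preserving_borel_version[OF T] by metis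
  note em = emeasure_push_fst[OF D M S(1)]
  have sets: "sets (push_fst T M) = sets (restrict_space borel unit_square)"
    by (simp add: push_fst_def)
  have m1: "emeasure (push_fst T M) ({0..x} \<times> {0..1}) = ennreal x" if x: "x \<in> {0..1}" for x
    using em[OF x _ section_density_marginal[OF D]] S(2)[OF x] borel_versionD(5)[OF S(1)] by simp
  have m2: "emeasure (push_fst T M) ({0..1} \<times> {0..y}) = ennreal y" if y: "y \<in> {0..1}" for y
  proof -
    obtain g where g: "section_density D y g" using ex_section_density[OF D y] by blast
    have "S -` {0..1} \<inter> {0..1} = {0..1}" using borel_versionD(3)[OF S(1)] by auto
    then show ?thesis
      using em[of 1, OF _ y g] section_densityD(4)[OF g, of 0 1] copulaD(4,5)[OF D y] by simp
  qed
  show "copula F" "cdf_measure F (push_fst T M)"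
    unfolding F_def by (rule copula_of_uniform_marginals[OF sets], fact m1, fact m2)+
qed

section \<open>The star product with a shuffle of the minimum copula\<close>
lemma copula_min: "copula min_copula"
  unfolding copula_def rect_vol_def min_copula_def by auto

lemma section_density_min:
  assumes "s \<in> {0..1}"
  shows "section_density min_copula s (indicator {..s})"
proof -
  have "(\<integral>\<^sup>+t\<in>{a..b}. ennreal (indicator {..s} t) \<partial>lborel) = ennreal (min_copula b s - min_copula a s)"
    if "0 \<le> a" "a \<le> b" "b \<le> 1" for a b
  proof -
    have "(\<integral>\<^sup>+t\<in>{a..b}. ennreal (indicator {..s} t) \<partial>lborel) = (\<integral>\<^sup>+t. indicator {a..min b s} t \<partial>lborel)"
      by (intro nn_integral_cong) (auto simp: indicator_def)
    also have "\<dots> = ennreal (min_copula b s - min_copula a s)"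
      using that by (auto simp: min_copula_def min_def emeasure_lborel_Icc_eq)
    finally show ?thesis .
  qed
  then show ?thesis by (auto simp: section_density_def indicator_def)
qed

text \<open>Since \<open>A(x,s)\<close> is the Lebesgue measure of \<open>B \<inter> [0,s]\<close> with \<open>B\<close> the preimage of \<open>[0,x]\<close>, the Lebesgue
differentiation theorem applies with the indicator of \<open>B\<close> as the density.\<close>
lemma AE_derivative_shuffle_of_min:
  assumes A: "copula A" and AT: "copula_measure A = push_fst T (copula_measure min_copula)"
    and TS: "borel_version T S"
    and x: "x \<in> {0..1}"
  shows "AE t in lborel. t \<in> {0<..<1} \<longrightarrow>
    ((\<lambda>s. A x s) has_real_derivative indicator (S -` {0..x} \<inter> {0..1}) t) (at t)"
proof (rule AE_has_real_derivative_density)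
  define B where "B = S -` {0..x} \<inter> {0..1}"
  have B[measurable]: "B \<in> sets borel" unfolding B_def by (rule borel_versionD(5)[OF TS])
  show "indicator (S -` {0..x} \<inter> {0..1}) \<in> borel_measurable borel" unfolding B_def[symmetric] by measurable
  fix a b :: real assume ab: "0 \<le> a" "a \<le> b" "b \<le> 1"
  show m: "A x a \<le> A x b" by (rule copula_mono_lipschitz2(1)[OF A ab x])
  have A_eq: "ennreal (A x s) = emeasure lborel (B \<inter> {..s})" if s: "s \<in> {0..1}" for s
  proof -
    have "ennreal (A x s) = emeasure (push_fst T (copula_measure min_copula)) ({0..x} \<times> {0..s})"
      using cdf_measure_D(3)[OF cdf_measure_copula_measure[OF A] x s] by (simp add: AT)
    also have "\<dots> = (\<integral>\<^sup>+t\<in>B. ennreal (indicator {..s} t) \<partial>lborel)"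
      unfolding B_def
      by (rule emeasure_push_fst[OF copula_min cdf_measure_copula_measure[OF copula_min] TS x s section_density_min[OF s]])
    also have "\<dots> = (\<integral>\<^sup>+t. indicator (B \<inter> {..s}) t \<partial>lborel)"
      by (intro nn_integral_cong) (auto simp: indicator_def)
    finally show ?thesis by simp
  qed
  have "(\<integral>\<^sup>+t\<in>{a..b}. ennreal (indicator B t) \<partial>lborel) = (\<integral>\<^sup>+t. indicator (B \<inter> {a..b}) t \<partial>lborel)"
    by (intro nn_integral_cong) (auto simp: indicator_def)
  also have "\<dots> = emeasure lborel (B \<inter> {a<..b})"
  proof -
    have "AE t in lborel. t \<noteq> a" by (rule AE_lborel_singleton)
    then have "AE t in lborel. (t \<in> B \<inter> {a..b}) = (t \<in> B \<inter> {a<..b})" by eventually_elim auto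
    then show ?thesis by (simp add: emeasure_eq_AE)
  qed
  also have "\<dots> = ennreal (A x b - A x a)"
  proof -
    have "emeasure lborel (B \<inter> {..b}) = emeasure lborel (B \<inter> {..a}) + emeasure lborel (B \<inter> {a<..b})"
      using ab by (subst plus_emeasure) (auto intro!: arg_cong[of _ _ "emeasure lborel"])
    then have "ennreal (A x b) = ennreal (A x a) + emeasure lborel (B \<inter> {a<..b})"
      using A_eq[of a] A_eq[of b] ab by simp
    then have "ennreal (A x b) - ennreal (A x a) = emeasure lborel (B \<inter> {a<..b})" by simp
    then show ?thesis using copulaD(1)[OF A x, of a] ab by (simp add: ennreal_minus)
  qed
  finally show "(\<integral>\<^sup>+t\<in>{a..b}. ennreal (indicator (S -` {0..x} \<inter> {0..1}) t) \<partial>lborel) = ennreal (A x b - A x a)"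
    unfolding B_def .
qed (auto simp: indicator_def)

text \<open>After the two derivatives are replaced by the indicator of \<open>B\<close> and by the section density of \<open>D\<close>,
the integral is the mass of \<open>B \<times> [0,y]\<close> under the measure of \<open>D\<close>.\<close>
lemma star_product_shuffle_of_min:
  assumes A: "copula A" and D: "copula D" and T: "measure_preserving T"
    and AT: "copula_measure A = push_fst T (copula_measure min_copula)"
    and x: "x \<in> {0..1}" and y: "y \<in> {0..1}"
  shows "star_product A D x y = measure (push_fst T (copula_measure D)) ({0..x} \<times> {0..y})"
proof -
  obtain S where S: "borel_version T S"
    using measure_preserving_borel_version[OF T] by metis
  define B where "B = S -` {0..x} \<inter> {0..1}"
  have B[measurable]: "B \<in> sets borel" unfolding B_def by (rule borel_versionD(5)[OF S])
  obtain g where g: "section_density D y g" using ex_section_density[OF D y] by blast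
  note [measurable] = section_densityD(1)[OF g]
  have "AE t in lborel. t \<in> {0<..<1} \<longrightarrow> ((\<lambda>s. A x s) has_real_derivative indicator B t) (at t)"
    unfolding B_def by (rule AE_derivative_shuffle_of_min[OF A AT S x])
  moreover have "AE t in lborel. t \<in> {0<..<1} \<longrightarrow> ((\<lambda>s. D s y) has_real_derivative g t) (at t)"
    by (rule AE_section_density_derivative[OF D y g])
  moreover have "AE t in lborel. t \<noteq> (0::real)" "AE t in lborel. t \<noteq> (1::real)"
    by (rule AE_lborel_singleton)+
  ultimately have "AE t in lborel. indicator B t * g t =
      indicator {0..1} t *\<^sub>R (deriv (\<lambda>s. A x s) t * deriv (\<lambda>s. D s y) t)"
  proof eventually_elim
    case (elim t)
    show ?case
    proof (cases "t \<in> {0..1}")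
      case True
      then have "t \<in> {0<..<1}" using elim by auto
      then show ?thesis using elim(1,2) True by (simp add: DERIV_imp_deriv)
    next
      case False
      then have "t \<notin> B" by (auto simp: B_def)
      then show ?thesis using False by simp
    qed
  qed
  then have AE: "AE t in lebesgue. indicator B t * g t =
      indicator {0..1} t *\<^sub>R (deriv (\<lambda>s. A x s) t * deriv (\<lambda>s. D s y) t)"
    by (simp add: AE_completion_iff)
  have m: "(\<lambda>t. indicator B t * g t) \<in> borel_measurable lborel" by measurable
  have "star_product A D x y = (LINT t|lebesgue. indicator B t * g t)"
    unfolding star_product_def set_lebesgue_integral_def
    using AE measurable_completion[OF m] borel_measurable_AE[OF measurable_completion[OF m] AE]
    by (intro integral_cong_AE) (auto simp: eq_commute)
  also have "\<dots> = (LINT t|lborel. indicator B t * g t)" by (rule integral_completion[OF m])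
  also have "\<dots> = enn2real (\<integral>\<^sup>+t. ennreal (indicator B t * g t) \<partial>lborel)"
    using section_densityD(2)[OF g] by (intro integral_eq_nn_integral m) auto
  also have "(\<integral>\<^sup>+t. ennreal (indicator B t * g t) \<partial>lborel) = (\<integral>\<^sup>+t\<in>B. ennreal (g t) \<partial>lborel)"
    by (intro nn_integral_cong) (auto simp: indicator_def)
  also have "\<dots> = emeasure (push_fst T (copula_measure D)) ({0..x} \<times> {0..y})"
    unfolding B_def
    by (rule emeasure_push_fst[OF D cdf_measure_copula_measure[OF D] S x y g, symmetric])
  finally show ?thesis by (simp add: measure_def)
qed

text \<open>Both implications compare distribution functions. From left to right, the witness \<open>A\<close> is the
distribution function of the measure of the minimum copula pushed forward by the same \<open>T\<close>.\<close>
lemma push_fst_iff_star_product: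
  assumes C: "copula C" and D: "copula D" and T: "measure_preserving T"
  shows "copula_measure C = push_fst T (copula_measure D) \<longleftrightarrow>
    (\<exists>A. copula A \<and> copula_measure A = push_fst T (copula_measure min_copula) \<and>
         (\<forall>x\<in>{0..1}. \<forall>y\<in>{0..1}. C x y = star_product A D x y))"
proof
  assume eq: "copula_measure C = push_fst T (copula_measure D)"
  note P = push_fst_cdf[OF copula_min cdf_measure_copula_measure[OF copula_min] T]
  define A where "A = (\<lambda>x y. measure (push_fst T (copula_measure min_copula)) ({0..x} \<times> {0..y}))"
  have A: "copula A" "copula_measure A = push_fst T (copula_measure min_copula)"
    unfolding A_def using P(1) copula_measure_eqI[OF P] by simp_all
  have "C x y = star_product A D x y" if xy: "x \<in> {0..1}" "y \<in> {0..1}" for x y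
    using cdf_measure_D(3)[OF cdf_measure_copula_measure[OF C] xy] copulaD(1)[OF C xy]
    unfolding star_product_shuffle_of_min[OF A(1) D T A(2) xy] eq by (simp add: measure_def)
  then show "\<exists>A. copula A \<and> copula_measure A = push_fst T (copula_measure min_copula) \<and>
         (\<forall>x\<in>{0..1}. \<forall>y\<in>{0..1}. C x y = star_product A D x y)"
    using A by blast
next
  assume "\<exists>A. copula A \<and> copula_measure A = push_fst T (copula_measure min_copula) \<and>
         (\<forall>x\<in>{0..1}. \<forall>y\<in>{0..1}. C x y = star_product A D x y)"
  then obtain A where A: "copula A" "copula_measure A = push_fst T (copula_measure min_copula)"
    and CA: "\<And>x y. x \<in> {0..1} \<Longrightarrow> y \<in> {0..1} \<Longrightarrow> C x y = star_product A D x y" by blast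
  note P = push_fst_cdf(2)[OF D cdf_measure_copula_measure[OF D] T]
  have "cdf_measure C (push_fst T (copula_measure D))"
    using P star_product_shuffle_of_min[OF A(1) D T A(2)] CA by (simp add: cdf_measure_def)
  then show "copula_measure C = push_fst T (copula_measure D)"
    by (rule copula_measure_eqI[OF C])
qed

theorem theorem4p6:
  fixes C D :: "real \<Rightarrow> real \<Rightarrow> real"
  assumes "copula C" and "copula D"
  shows "(shuffle C D \<longleftrightarrow>
            (\<exists>A. shuffle A min_copula \<and>
                 (\<forall>x\<in>{0..1}. \<forall>y\<in>{0..1}. C x y = star_product A D x y))) \<and>
         (generalized_shuffle C D \<longleftrightarrow>
            (\<exists>A. generalized_shuffle A min_copula \<and>
                 (\<forall>x\<in>{0..1}. \<forall>y\<in>{0..1}. C x y = star_product A D x y)))"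
  using push_fst_iff_star_product[OF assms] assms copula_min
  unfolding shuffle_def generalized_shuffle_def by blast

end
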